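(* Let $f\in\mathbb{C}[x,y]$ be a nonzero binary form of degree $6$ which is stable (all its roots in $\mathbb{P}^1$ have multiplicity at most $2$) and satisfies $I_4(f)=0$. Then one and only one of the following cases occurs. (1) $I_2(f)^3+I_6(f)\neq 0$, and then $\operatorname{rank} f=3$. (2) $I_2(f)^3+I_6(f)=0$, and then (a) either $\operatorname{rank} f=2$ and $\pi(f)=(1:0:-1:1)$, or (b) $\operatorname{rank} f=5$, and $\pi(f)=(0:0:0:1)$ or $\pi(f)=(1:0:-1:t)$ for some $t\in\mathbb{C}$ with $t\neq 1$.
   Context: The Waring rank $\operatorname{rank} f$ of a nonzero binary form $f$ of degree $d$ is the minimal $r$ such that $f=\ell_1^d+\cdots+\ell_r^d$ with $\ell_j\in\mathbb{C}[x,y]$ linear forms. Write a binary sextic as $$f=a_0x^6+6a_1x^5y+15a_2x^4y^2+20a_3x^3y^3+15a_4x^2y^4+6a_5xy^5+a_6y^6 .$$ Define $$I_2(f)=-10a_3^2+15a_2a_4-6a_1a_5+a_0a_6,$$ $$I_4(f)=\det\begin{pmatrix} a_0 & a_1 & a_2 & a_3 \\ a_1 & a_2 & a_3 & a_4 \\ a_2 & a_3 & a_4 & a_5 \\ a_3 & a_4 & a_5 & a_6 \end{pmatrix},$$ $$I_6(f)=\det\begin{pmatrix} b_0 & b_1 & b_2 \\ b_1 & b_2 & b_3 \\ b_2 & b_3 & b_4 \end{pmatrix},$$ where $b_0=6(a_0a_4-4a_1a_3+3a_2^2)$, $b_1=3(a_0a_5-3a_1a_4+2a_2a_3)$, $b_2=a_0a_6-9a_2a_4+8a_3^2$,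 $b_3=3(a_1a_6-3a_2a_5+2a_3a_4)$, $b_4=6(a_2a_6-4a_3a_5+3a_4^2)$, and $$I_{10}(f)=6^{-10}\Delta(f),$$ where $\Delta(f)=\operatorname{Res}(\partial f/\partial x,\partial f/\partial y)$ is the discriminant of $f$, i.e. the resultant of the two partial derivatives viewed as binary quintics, normalized by $\operatorname{Res}(x^5,y^5)=1$ (so that $I_{10}(x^6+y^6)=1$). $\mathbb{P}(1,2,3,5)$ is the weighted projective space, with $(z_1:z_2:z_3:z_5)=(\lambda z_1:\lambda^2z_2:\lambda^3z_3:\lambda^5z_5)$ for $\lambda\in\mathbb{C}^*$. For a sextic $f$ with no root of multiplicity greater than $3$, set $\pi(f)=(I_2(f):I_4(f):I_6(f):I_{10}(f))\in\mathbb{P}(1,2,3,5)$. *)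

theory Defs
  imports
    "Subresultants.Resultant_Prelim"
    "HOL-Computational_Algebra.Field_as_Ring"
begin

text \<open>
  The ring \<open>\<complex>[x,y]\<close> is \<^typ>\<open>complex poly poly\<close>, read as \<open>\<complex>[x][y]\<close>: the inner variable is \<open>x\<close>,
  the outer one is \<open>y\<close>, and \<open>coeff (coeff f j) i\<close> is the coefficient of \<open>x\<^sup>i y\<^sup>j\<close>.
\<close>

definition var_x :: "complex poly poly" where
  "var_x = [:[:0, 1:]:]"

definition var_y :: "complex poly poly" where
  "var_y = [:0, 1:]"

definition cst :: "complex \<Rightarrow> complex poly poly" where
  "cst c = [:[:c:]:]"

text \<open>Homogeneous polynomials of degree \<open>d\<close>; the zero polynomial is included.\<close>

definition binary_form :: "nat \<Rightarrow> complex poly poly \<Rightarrow> bool" where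
  "binary_form d f \<longleftrightarrow> (\<forall>i j. coeff (coeff f j) i \<noteq> 0 \<longrightarrow> i + j = d)"

definition partial_x :: "complex poly poly \<Rightarrow> complex poly poly" where
  "partial_x f = map_poly pderiv f"

definition partial_y :: "complex poly poly \<Rightarrow> complex poly poly" where
  "partial_y f = pderiv f"

definition waring_rank :: "nat \<Rightarrow> complex poly poly \<Rightarrow> nat" where
  "waring_rank d f =
     (LEAST r. \<exists>l :: nat \<Rightarrow> complex poly poly.
        (\<forall>j<r. binary_form 1 (l j)) \<and> f = (\<Sum>j<r. l j ^ d))"

text \<open>
  The multiplicity of the point \<open>(p : q)\<close> of the projective line as a root of \<open>f\<close> is the
  multiplicity in \<open>f\<close> of the linear form \<open>q x - p y\<close> vanishing there (\<open>0\<close> if it is not a root).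
  It is meaningful for \<open>f \<noteq> 0\<close> and \<open>(p, q) \<noteq> (0, 0)\<close>.
\<close>

definition root_mult :: "complex poly poly \<Rightarrow> complex \<Rightarrow> complex \<Rightarrow> nat" where
  "root_mult f p q = multiplicity (cst q * var_x - cst p * var_y) f"

definition stable_sextic :: "complex poly poly \<Rightarrow> bool" where
  "stable_sextic f \<longleftrightarrow>
     f \<noteq> 0 \<and> (\<forall>p q. (p, q) \<noteq> (0, 0) \<longrightarrow> root_mult f p q \<le> 2)"

text \<open>
  \<open>sextic_coeff f i\<close> is the coefficient \<open>a\<^sub>i\<close> in
  \<open>f = (\<Sum>i\<le>6. (6 choose i) a\<^sub>i x\<^sup>6\<^sup>-\<^sup>i y\<^sup>i)\<close>.
\<close>

definition sextic_coeff :: "complex poly poly \<Rightarrow> nat \<Rightarrow> complex" where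
  "sextic_coeff f i = coeff (coeff f i) (6 - i) / of_nat (6 choose i)"

definition I2 :: "complex poly poly \<Rightarrow> complex" where
  "I2 f = (let a = sextic_coeff f in
     - 10 * (a 3)^2 + 15 * a 2 * a 4 - 6 * a 1 * a 5 + a 0 * a 6)"

definition I4 :: "complex poly poly \<Rightarrow> complex" where
  "I4 f = (let a = sextic_coeff f in
     det (mat_of_rows_list 4
       [[a 0, a 1, a 2, a 3],
        [a 1, a 2, a 3, a 4],
        [a 2, a 3, a 4, a 5],
        [a 3, a 4, a 5, a 6]]))"

definition I6 :: "complex poly poly \<Rightarrow> complex" where
  "I6 f = (let a = sextic_coeff f;
       b0 = 6 * (a 0 * a 4 - 4 * a 1 * a 3 + 3 * (a 2)^2);
       b1 = 3 * (a 0 * a 5 - 3 * a 1 * a 4 + 2 * a 2 * a 3);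
       b2 = a 0 * a 6 - 9 * a 2 * a 4 + 8 * (a 3)^2;
       b3 = 3 * (a 1 * a 6 - 3 * a 2 * a 5 + 2 * a 3 * a 4);
       b4 = 6 * (a 2 * a 6 - 4 * a 3 * a 5 + 3 * (a 4)^2)
     in det (mat_of_rows_list 3
       [[b0, b1, b2],
        [b1, b2, b3],
        [b2, b3, b4]]))"

text \<open>
  The resultant of two binary forms of degrees \<open>m\<close> and \<open>n\<close>. Setting \<open>y = 1\<close> (\<open>poly f 1\<close>) loses
  no coefficient, but the degree may drop; hence the Sylvester matrix is taken with the formal
  degrees \<open>m, n\<close>, and the library constant \<open>resultant\<close>, which uses actual degrees, would be wrong.
\<close>

definition form_resultant ::
    "nat \<Rightarrow> nat \<Rightarrow> complex poly poly \<Rightarrow> complex poly poly \<Rightarrow> complex" where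
  "form_resultant m n f g = det (sylvester_mat_sub m n (poly f 1) (poly g 1))"

definition sextic_discriminant :: "complex poly poly \<Rightarrow> complex" where
  "sextic_discriminant f = form_resultant 5 5 (partial_x f) (partial_y f)"

definition I10 :: "complex poly poly \<Rightarrow> complex" where
  "I10 f = sextic_discriminant f / 6 ^ 10"

text \<open>
  Points of the weighted projective space \<open>P(1,2,3,5)\<close> are the equivalence classes of nonzero
  vectors under the weighted action of the nonzero complex numbers. The zero vector is not
  related to anything, so \<open>wpoint 0 0 0 0\<close> is the empty set, which is not a point.
\<close>

definition wproj_rel ::
    "((complex \<times> complex \<times> complex \<times> complex) \<times> (complex \<times> complex \<times> complex \<times> complex)) set" where
  "wproj_rel = {((z1, z2, z3, z5), (w1, w2, w3, w5)).
     (z1, z2, z3, z5) \<noteq> (0, 0, 0, 0) \<and>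
     (\<exists>c. c \<noteq> 0 \<and> w1 = c * z1 \<and> w2 = c^2 * z2 \<and> w3 = c^3 * z3 \<and> w5 = c^5 * z5)}"

definition wproj_space :: "(complex \<times> complex \<times> complex \<times> complex) set set" where
  "wproj_space = (UNIV - {(0, 0, 0, 0)}) // wproj_rel"

definition wpoint ::
    "complex \<Rightarrow> complex \<Rightarrow> complex \<Rightarrow> complex \<Rightarrow> (complex \<times> complex \<times> complex \<times> complex) set" where
  "wpoint z1 z2 z3 z5 = wproj_rel `` {(z1, z2, z3, z5)}"

definition sextic_point ::
    "complex poly poly \<Rightarrow> (complex \<times> complex \<times> complex \<times> complex) set" where
  "sextic_point f = wpoint (I2 f) (I4 f) (I6 f) (I10 f)"

lemma equiv_wproj_rel: "equiv (UNIV - {(0, 0, 0, 0)}) wproj_rel"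
proof (rule equivI)
  show "refl_on (UNIV - {(0, 0, 0, 0)}) wproj_rel"
    by (auto simp: refl_on_def wproj_rel_def intro!: exI[of _ 1])
  show "wproj_rel \<subseteq> (UNIV - {(0, 0, 0, 0)}) \<times> (UNIV - {(0, 0, 0, 0)})"
    by (auto simp: wproj_rel_def)
  show "sym wproj_rel"
  proof (rule symI, clarify)
    fix z1 z2 z3 z5 w1 w2 w3 w5
    assume "((z1, z2, z3, z5), (w1, w2, w3, w5)) \<in> wproj_rel"
    then obtain c where "c \<noteq> 0" "(z1, z2, z3, z5) \<noteq> (0, 0, 0, 0)"
      "w1 = c * z1" "w2 = c^2 * z2" "w3 = c^3 * z3" "w5 = c^5 * z5"
      by (auto simp: wproj_rel_def)
    then show "((w1, w2, w3, w5), (z1, z2, z3, z5)) \<in> wproj_rel"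
      by (auto simp: wproj_rel_def field_simps intro!: exI[of _ "inverse c"])
  qed
  show "trans wproj_rel"
  proof (rule transI, clarify)
    fix z1 z2 z3 z5 w1 w2 w3 w5 u1 u2 u3 u5
    assume "((z1, z2, z3, z5), (w1, w2, w3, w5)) \<in> wproj_rel"
      and "((w1, w2, w3, w5), (u1, u2, u3, u5)) \<in> wproj_rel"
    then obtain c d where "c \<noteq> 0" "d \<noteq> 0" "(z1, z2, z3, z5) \<noteq> (0, 0, 0, 0)"
      "w1 = c * z1" "w2 = c^2 * z2" "w3 = c^3 * z3" "w5 = c^5 * z5"
      "u1 = d * w1" "u2 = d^2 * w2" "u3 = d^3 * w3" "u5 = d^5 * w5"
      by (auto simp: wproj_rel_def)
    then show "((z1, z2, z3, z5), (u1, u2, u3, u5)) \<in> wproj_rel"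
      by (auto simp: wproj_rel_def power_mult_distrib intro!: exI[of _ "d * c"])
  qed
qed

lemma wpoint_in_wproj_space:
  assumes "(z1, z2, z3, z5) \<noteq> (0, 0, 0, 0)"
  shows "wpoint z1 z2 z3 z5 \<in> wproj_space"
  unfolding wpoint_def wproj_space_def by (rule quotientI) (use assms in simp)

lemma binary_form_6_expansion:
  assumes "binary_form 6 f"
  shows "f = (\<Sum>i\<le>6. cst (of_nat (6 choose i) * sextic_coeff f i) * var_x ^ (6 - i) * var_y ^ i)"
proof -
  have X: "var_x ^ n = [:monom 1 n:]" for n
    by (induction n) (auto simp: var_x_def monom_Suc one_pCons monom_0)
  have Y: "var_y ^ n = monom 1 n" for n
    by (induction n) (auto simp: var_y_def monom_Suc one_pCons monom_0)
  have mon: "cst c * var_x ^ k * var_y ^ n = monom (monom c k) n" for c k n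
    by (simp add: X Y cst_def smult_monom)
  show ?thesis
  proof (intro poly_eqI)
    fix i j
    show "coeff (coeff f j) i = coeff (coeff (\<Sum>i\<le>6. cst (of_nat (6 choose i) * sextic_coeff f i)
            * var_x ^ (6 - i) * var_y ^ i) j) i"
    proof (cases "j \<le> 6 \<and> i = 6 - j")
      case True
      then have "6 choose j \<noteq> 0" by simp
      with True show ?thesis
        by (simp add: mon coeff_sum sextic_coeff_def if_distrib[of "\<lambda>p. coeff p _"]
            cong: if_cong)
    next
      case False
      then have "i + j \<noteq> 6" by auto
      then have "coeff (coeff f j) i = 0"
        using assms unfolding binary_form_def by blast
      then show ?thesis using False
        by (auto simp: mon coeff_sum if_distrib[of "\<lambda>p. coeff p _"] cong: if_cong)
    qed
  qed
qed

lemma form_resultant_normalization: "form_resultant 5 5 (var_x ^ 5) (var_y ^ 5) = 1"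
proof -
  have X: "poly (var_x ^ 5) 1 = monom 1 5"
    by (simp add: var_x_def monom_altdef)
  have Y: "poly (var_y ^ 5) 1 = 1"
    by (simp add: var_y_def)
  have "sylvester_mat_sub 5 5 (monom 1 5) 1 = (1\<^sub>m 10 :: complex mat)"
    by (rule eq_matI) (auto simp: sylvester_mat_sub_index)
  then show ?thesis by (simp only: form_resultant_def X Y det_one)
qed

end

theory Submission
  imports Defs "HOL-Computational_Algebra.Fundamental_Theorem_Algebra"
begin

text \<open>
  A sextic with \<open>I\<^sub>4 = 0\<close> is annihilated by a nonzero cubic differential operator, which splits
  into three linear ones over the complex numbers; a triple factor would give the sextic a triple
  root. Otherwise two of the factors are independent, and shears and the flip \<open>x \<leftrightarrow> y\<close>,
  which preserve rank, stability and all invariants, turn them into \<open>\<partial>/\<partial>x\<close> and \<open>\<partial>/\<partial>y\<close>.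
  The third factor then leaves two normal forms. If it differs from both, the sextic is
  \<open>\<alpha> x\<^sup>6 + \<beta> y\<^sup>6 + \<gamma> (x + r y)\<^sup>6\<close>, and \<open>I\<^sub>2\<^sup>3 + I\<^sub>6\<close> is \<open>54 (\<alpha> \<beta> \<gamma> r\<^sup>3)\<^sup>2\<close>, so it
  vanishes iff the rank is at most 2. If it coincides with one of them, the sextic is
  \<open>a\<^sub>0 x\<^sup>6 + 6 a\<^sub>5 x y\<^sup>5 + a\<^sub>6 y\<^sup>6\<close> up to a flip, with \<open>I\<^sub>2 = a\<^sub>0 a\<^sub>6\<close>,
  \<open>I\<^sub>6 = - I\<^sub>2\<^sup>3\<close> and \<open>I\<^sub>1\<^sub>0 = I\<^sub>2\<^sup>5 - 5\<^sup>5 a\<^sub>0\<^sup>4 a\<^sub>5\<^sup>6\<close>; the rank is 2 if \<open>a\<^sub>5 = 0\<close>, and otherwise 5: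
  a sum of four sixth powers would force \<open>a\<^sub>5 = 0\<close>, while five always suffice. The discriminant is handled through the five by five
  Bezout matrix, to which the ten by ten Sylvester determinant reduces.
\<close>

subsection \<open>Shears, flips and contractions of coefficient sequences\<close>

text \<open>
  A sequence \<open>a\<close> stands for the form \<open>\<Sum>i. (n choose i) a\<^sub>i x\<^sup>n\<^sup>-\<^sup>i y\<^sup>i\<close>; then \<open>(p x + q y)\<^sup>n\<close> is
  \<open>p\<^sup>n\<^sup>-\<^sup>i q\<^sup>i\<close>, and neither a shear \<open>x \<mapsto> x + t y\<close> nor, up to a factor \<open>n\<close>, the derivative
  \<open>v \<partial>/\<partial>x - u \<partial>/\<partial>y\<close> depends on the degree \<open>n\<close>.
\<close>

fun shear :: "complex \<Rightarrow> (nat \<Rightarrow> complex) \<Rightarrow> nat \<Rightarrow> complex" where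
  "shear t a 0 = a 0"
| "shear t a (Suc i) = shear t (\<lambda>j. a (Suc j)) i + t * shear t a i"

definition flip :: "(nat \<Rightarrow> complex) \<Rightarrow> nat \<Rightarrow> complex" where
  "flip a i = a (6 - i)"

definition contract :: "complex \<Rightarrow> complex \<Rightarrow> (nat \<Rightarrow> complex) \<Rightarrow> nat \<Rightarrow> complex" where
  "contract u v a i = v * a i - u * a (Suc i)"

lemma shear_linear:
  "shear t (\<lambda>i. c * a i + d * b i) i = c * shear t a i + d * shear t b i"
  by (induction i arbitrary: a b) (simp_all add: algebra_simps)

lemma shear_sum: "shear t (\<lambda>i. \<Sum>j\<in>A. f j i) i = (\<Sum>j\<in>A. shear t (f j) i)"
  by (induction i arbitrary: f) (simp_all add: sum.distrib sum_distrib_left)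

lemma shear_cong: "(\<And>j. j \<le> i \<Longrightarrow> a j = b j) \<Longrightarrow> shear t a i = shear t b i"
proof (induction i arbitrary: a b)
  case (Suc i)
  have "shear t (\<lambda>j. a (Suc j)) i = shear t (\<lambda>j. b (Suc j)) i" "shear t a i = shear t b i"
    by (rule Suc.IH; simp add: Suc.prems)+
  then show ?case by simp
qed simp

lemma shear_const_zero: "shear t (\<lambda>i. 0) i = 0"
  by (induction i) simp_all

lemma shear_zero: "(\<And>j. j \<le> i \<Longrightarrow> a j = 0) \<Longrightarrow> shear t a i = 0"
  using shear_cong[of i a "\<lambda>_. 0" t] by (simp add: shear_const_zero)

lemma shear_shear: "shear s (shear t a) i = shear (s + t) a i"
proof (induction i arbitrary: a)
  case (Suc i)
  have "shear s (\<lambda>j. shear t a (Suc j)) i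
      = shear s (shear t (\<lambda>j. a (Suc j))) i + t * shear s (shear t a) i"
    using shear_linear[of s 1 "shear t (\<lambda>j. a (Suc j))" t "shear t a" i] by simp
  then show ?case by (simp add: Suc.IH algebra_simps)
qed simp

lemma shear_0: "shear 0 a i = a i"
  by (induction i arbitrary: a) simp_all

lemma shear_inverse: "shear (- t) (shear t a) = a"
  by (rule ext) (simp add: shear_shear shear_0)

text \<open>Substituting x + t y for x turns p x + q y into p x + (q + t p) y, and its powers
  accordingly.\<close>

lemma shear_power:
  "i \<le> n \<Longrightarrow> shear t (\<lambda>i. p ^ (n - i) * q ^ i) i = p ^ (n - i) * (q + t * p) ^ i"
proof (induction i arbitrary: n)
  case (Suc i)
  then obtain m where n: "n = Suc m" "i \<le> m" by (cases n) auto
  have "shear t (\<lambda>j. p ^ (n - Suc j) * q ^ Suc j) i = q * (p ^ (m - i) * (q + t * p) ^ i)"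
    using shear_linear[of t q "\<lambda>j. p ^ (m - j) * q ^ j" 0 "\<lambda>j. 0" i] Suc.IH[OF n(2)] n(1)
    by (simp add: ac_simps)
  moreover have "shear t (\<lambda>i. p ^ (n - i) * q ^ i) i = p * p ^ (m - i) * (q + t * p) ^ i"
    using Suc.IH[of n] n by (simp add: Suc_diff_le)
  ultimately show ?case
    using n(1) by (simp add: algebra_simps)
qed simp

text \<open>Chain rule for x \<mapsto> x + t y: the point (u, v) that parametrizes the derivative is
  sheared along with the form.\<close>

lemma contract_shear: "contract u (v + t * u) (shear t a) = shear t (contract u v a)"
proof
  fix i
  have "contract u v a = (\<lambda>i. v * a i + - u * a (Suc i))"
    by (rule ext) (simp add: contract_def)
  then have "shear t (contract u v a) i = v * shear t a i - u * shear t (\<lambda>j. a (Suc j)) i"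
    using shear_linear[of t v a "- u" "\<lambda>j. a (Suc j)" i] by simp
  then show "contract u (v + t * u) (shear t a) i = shear t (contract u v a) i"
    by (simp add: contract_def[of _ _ "shear t a"] algebra_simps)
qed

lemma contract_commute:
  "contract u v (contract u' v' a) = contract u' v' (contract u v a)"
proof
  fix i
  show "contract u v (contract u' v' a) i = contract u' v' (contract u v a) i"
    unfolding contract_def by (simp add: algebra_simps)
qed

lemma contract_funpow_shear:
  "(contract u (v + t * u) ^^ n) (shear t a) = shear t ((contract u v ^^ n) a)"
  by (induction n) (simp_all add: contract_shear)

text \<open>The operator q \<partial>/\<partial>x - p \<partial>/\<partial>y kills p x + q y, hence
  its powers. This is how power sums lead to annihilating operators.\<close>

lemma contract_power:
  assumes "i < n" shows "contract p q (\<lambda>i. p ^ (n - i) * q ^ i) i = 0"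
proof -
  have "n - i = Suc (n - Suc i)" using assms by simp
  then show ?thesis by (simp add: contract_def)
qed

lemma shear_values:
  "shear t a 1 = a 1 + t * a 0"
  "shear t a 2 = a 2 + 2 * t * a 1 + t^2 * a 0"
  "shear t a 3 = a 3 + 3 * t * a 2 + 3 * t^2 * a 1 + t^3 * a 0"
  "shear t a 4 = a 4 + 4 * t * a 3 + 6 * t^2 * a 2 + 4 * t^3 * a 1 + t^4 * a 0"
  "shear t a 5 = a 5 + 5 * t * a 4 + 10 * t^2 * a 3 + 10 * t^3 * a 2 + 5 * t^4 * a 1 + t^5 * a 0"
  "shear t a 6 = a 6 + 6 * t * a 5 + 15 * t^2 * a 4 + 20 * t^3 * a 3 + 15 * t^4 * a 2
     + 6 * t^5 * a 1 + t^6 * a 0"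
proof -
  \<comment> \<open>Each expansion stays general in \<open>a\<close>, because the next one uses it
    for the shifted sequence too.\<close>
  have 1: "shear t a 1 = a 1 + t * a 0" for a by simp
  have s: "shear t a 2 = shear t (\<lambda>j. a (Suc j)) 1 + t * shear t a 1" for a
    by (metis Suc_1 shear.simps(2))
  have 2: "shear t a 2 = a 2 + 2 * t * a 1 + t^2 * a 0" for a
    unfolding s 1 by (simp add: algebra_simps power_numeral_reduce numeral_2_eq_2)
  have s: "shear t a 3 = shear t (\<lambda>j. a (Suc j)) 2 + t * shear t a 2" for a
    using shear.simps(2)[of t a 2] by (simp add: del: shear.simps)
  have 3: "shear t a 3 = a 3 + 3 * t * a 2 + 3 * t^2 * a 1 + t^3 * a 0" for a
    unfolding s 2 by (simp add: algebra_simps power_numeral_reduce numeral_2_eq_2[symmetric])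
  have s: "shear t a 4 = shear t (\<lambda>j. a (Suc j)) 3 + t * shear t a 3" for a
    using shear.simps(2)[of t a 3] by (simp add: del: shear.simps)
  have 4: "shear t a 4 = a 4 + 4 * t * a 3 + 6 * t^2 * a 2 + 4 * t^3 * a 1 + t^4 * a 0" for a
    unfolding s 3 by (simp add: algebra_simps power_numeral_reduce numeral_2_eq_2[symmetric])
  have s: "shear t a 5 = shear t (\<lambda>j. a (Suc j)) 4 + t * shear t a 4" for a
    using shear.simps(2)[of t a 4] by (simp add: del: shear.simps)
  have 5: "shear t a 5 = a 5 + 5 * t * a 4 + 10 * t^2 * a 3 + 10 * t^3 * a 2 + 5 * t^4 * a 1 + t^5 * a 0" for a
    unfolding s 4 by (simp add: algebra_simps power_numeral_reduce numeral_2_eq_2[symmetric])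
  have s: "shear t a 6 = shear t (\<lambda>j. a (Suc j)) 5 + t * shear t a 5" for a
    using shear.simps(2)[of t a 5] by (simp add: del: shear.simps)
  have 6: "shear t a 6 = a 6 + 6 * t * a 5 + 15 * t^2 * a 4 + 20 * t^3 * a 3 + 15 * t^4 * a 2
     + 6 * t^5 * a 1 + t^6 * a 0" for a
    unfolding s 5 by (simp add: algebra_simps power_numeral_reduce numeral_2_eq_2[symmetric])
  show "shear t a 1 = a 1 + t * a 0" "shear t a 2 = a 2 + 2 * t * a 1 + t^2 * a 0" "shear t a 3 = a 3 + 3 * t * a 2 + 3 * t^2 * a 1 + t^3 * a 0" "shear t a 4 = a 4 + 4 * t * a 3 + 6 * t^2 * a 2 + 4 * t^3 * a 1 + t^4 * a 0" "shear t a 5 = a 5 + 5 * t * a 4 + 10 * t^2 * a 3 + 10 * t^3 * a 2 + 5 * t^4 * a 1 + t^5 * a 0" "shear t a 6 = a 6 + 6 * t * a 5 + 15 * t^2 * a 4 + 20 * t^3 * a 3 + 15 * t^4 * a 2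
     + 6 * t^5 * a 1 + t^6 * a 0"
    by (rule 1 2 3 4 5 6)+
qed

text \<open>The sextic with coefficients \<open>a\<close> has a root of multiplicity at least 3 iff all its second
  partial derivatives vanish at that point; they are evaluated by four contractions.\<close>

definition triple_root :: "(nat \<Rightarrow> complex) \<Rightarrow> bool" where
  "triple_root a \<longleftrightarrow> (\<exists>u v. (u, v) \<noteq> (0, 0) \<and> (\<forall>k\<le>2. (contract u v ^^ 4) a k = 0))"

text \<open>The linear forms are \<open>p j\<close> x + \<open>q j\<close> y. Zero forms are
  allowed, so this expresses rank at most \<open>r\<close>; entries beyond index 6 are
  ignored.\<close>

definition power_sum :: "nat \<Rightarrow> (nat \<Rightarrow> complex) \<Rightarrow> bool" where
  "power_sum r a \<longleftrightarrow> (\<exists>p q. \<forall>i\<le>6. a i = (\<Sum>j<r. p j ^ (6 - i) * q j ^ i))"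

lemma triple_root_shear_imp: "triple_root a \<Longrightarrow> triple_root (shear t a)"
proof -
  assume "triple_root a"
  then obtain u v where uv: "(u, v) \<noteq> (0, 0)" "\<And>k. k \<le> 2 \<Longrightarrow> (contract u v ^^ 4) a k = 0"
    unfolding triple_root_def by blast
  have "(u, v + t * u) \<noteq> (0, 0)" using uv(1) by auto
  moreover have "(contract u (v + t * u) ^^ 4) (shear t a) k = 0" if "k \<le> 2" for k
    unfolding contract_funpow_shear by (rule shear_zero) (use uv(2) that in auto)
  ultimately show ?thesis unfolding triple_root_def by blast
qed

lemma triple_root_shear: "triple_root (shear t a) \<longleftrightarrow> triple_root a"
  using triple_root_shear_imp[of "shear t a" "- t"] triple_root_shear_imp[of a t]
  by (auto simp: shear_inverse)

lemma power_sum_shear_imp: "power_sum r a \<Longrightarrow> power_sum r (shear t a)"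
proof -
  assume "power_sum r a"
  then obtain p q where pq: "\<And>i. i \<le> 6 \<Longrightarrow> a i = (\<Sum>j<r. p j ^ (6 - i) * q j ^ i)"
    unfolding power_sum_def by blast
  have "shear t a i = (\<Sum>j<r. p j ^ (6 - i) * (q j + t * p j) ^ i)" if "i \<le> 6" for i
  proof -
    have "shear t a i = shear t (\<lambda>i. \<Sum>j<r. p j ^ (6 - i) * q j ^ i) i"
      by (rule shear_cong) (use pq that in simp)
    then show ?thesis by (simp add: shear_sum shear_power that)
  qed
  then show ?thesis unfolding power_sum_def
    by (rule_tac x = p in exI, rule_tac x = "\<lambda>j. q j + t * p j" in exI) simp
qed

lemma power_sum_shear: "power_sum r (shear t a) \<longleftrightarrow> power_sum r a"
  using power_sum_shear_imp[of r "shear t a" "- t"] power_sum_shear_imp[of r a t]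
  by (auto simp: shear_inverse)

text \<open>Exchanging x and y turns u \<partial>/\<partial>x - v \<partial>/\<partial>y into minus
  the operator with the coordinates of its point exchanged. Each contraction therefore costs a sign
  and lowers by one the degree about which the coefficients are reversed.\<close>

lemma contract_funpow_flip:
  "k + n \<le> 6 \<Longrightarrow>
    (contract v u ^^ n) (flip a) k = (-1) ^ n * (contract u v ^^ n) a (6 - n - k)"
proof (induction n arbitrary: k)
  case (Suc n)
  have eq: "Suc (6 - Suc n - k) = 6 - n - k" "6 - n - Suc k = 6 - Suc n - k"
    using Suc.prems by auto
  have "(contract v u ^^ Suc n) (flip a) k
      = u * (contract v u ^^ n) (flip a) k - v * (contract v u ^^ n) (flip a) (Suc k)"
    by (simp add: contract_def[of v u _ k])
  also have "\<dots> = (-1) ^ n * (u * (contract u v ^^ n) a (Suc (6 - Suc n - k))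
      - v * (contract u v ^^ n) a (6 - Suc n - k))"
    using Suc.IH[of k] Suc.IH[of "Suc k"] Suc.prems unfolding eq by (simp add: right_diff_distrib)
  also have "\<dots> = (-1) ^ Suc n * (contract u v ^^ Suc n) a (6 - Suc n - k)"
    unfolding funpow.simps comp_def contract_def[of u v _ "6 - Suc n - k"]
    by (simp only: power_Suc) (simp add: right_diff_distrib del: diff_Suc_eq_diff_pred)
  finally show ?case .
qed (simp add: flip_def)

lemma contract_funpow_cong:
  "(\<And>i. i \<le> n + k \<Longrightarrow> a i = b i) \<Longrightarrow> (contract u v ^^ n) a k = (contract u v ^^ n) b k"
proof (induction n arbitrary: k)
  case (Suc n)
  have "(contract u v ^^ n) a k = (contract u v ^^ n) b k"
    "(contract u v ^^ n) a (Suc k) = (contract u v ^^ n) b (Suc k)"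
    by (rule Suc.IH; simp add: Suc.prems)+
  then show ?case by (simp add: contract_def[of u v _ k])
qed simp

lemma triple_root_flip_imp: "triple_root a \<Longrightarrow> triple_root (flip a)"
proof -
  assume "triple_root a"
  then obtain u v where uv: "(u, v) \<noteq> (0, 0)" "\<And>k. k \<le> 2 \<Longrightarrow> (contract u v ^^ 4) a k = 0"
    unfolding triple_root_def by blast
  have "(v, u) \<noteq> (0, 0)" using uv(1) by auto
  moreover have "(contract v u ^^ 4) (flip a) k = 0" if "k \<le> 2" for k
    using that uv(2)[of "6 - 4 - k"] contract_funpow_flip[of k 4 v u a] by simp
  ultimately show ?thesis unfolding triple_root_def by blast
qed

lemma triple_root_cong:
  assumes "\<And>i. i \<le> 6 \<Longrightarrow> a i = b i"
  shows "triple_root a \<longleftrightarrow> triple_root b"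
proof -
  have "(contract u v ^^ 4) a k = (contract u v ^^ 4) b k" if "k \<le> 2" for u v k
    by (rule contract_funpow_cong) (use assms that in simp)
  then show ?thesis unfolding triple_root_def by auto
qed

text \<open>Beyond index 6 truncated subtraction makes \<open>flip a\<close> constantly
  \<open>a 0\<close>, so \<open>flip\<close> is no involution on whole sequences; the congruence
  lemmas bridge this gap.\<close>

lemma flip_flip: "i \<le> 6 \<Longrightarrow> flip (flip a) i = a i"
  by (simp add: flip_def)

lemma triple_root_flip: "triple_root (flip a) \<longleftrightarrow> triple_root a"
proof
  assume "triple_root (flip a)"
  then have "triple_root (flip (flip a))" by (rule triple_root_flip_imp)
  then show "triple_root a" by (subst triple_root_cong[of a "flip (flip a)"]) (simp_all add: flip_flip)
qed (rule triple_root_flip_imp)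

lemma power_sum_flip_imp: "power_sum r a \<Longrightarrow> power_sum r (flip a)"
proof -
  assume "power_sum r a"
  then obtain p q where pq: "\<And>i. i \<le> 6 \<Longrightarrow> a i = (\<Sum>j<r. p j ^ (6 - i) * q j ^ i)"
    unfolding power_sum_def by blast
  have "flip a i = (\<Sum>j<r. q j ^ (6 - i) * p j ^ i)" if "i \<le> 6" for i
    using that pq[of "6 - i"] by (simp add: flip_def mult.commute)
  then show ?thesis unfolding power_sum_def by blast
qed

lemma power_sum_cong: "(\<And>i. i \<le> 6 \<Longrightarrow> a i = b i) \<Longrightarrow> power_sum r a \<longleftrightarrow> power_sum r b"
  unfolding power_sum_def by auto

lemma power_sum_flip: "power_sum r (flip a) \<longleftrightarrow> power_sum r a"
proof
  assume "power_sum r (flip a)"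
  then have "power_sum r (flip (flip a))" by (rule power_sum_flip_imp)
  then show "power_sum r a" by (subst power_sum_cong[of a "flip (flip a)"]) (simp_all add: flip_flip)
qed (rule power_sum_flip_imp)

text \<open>Padding with zero forms: the exponents \<open>6 - i\<close> and \<open>i\<close> are
  never both 0, so these contribute nothing, even with \<open>0 ^ 0 = 1\<close>.\<close>

lemma power_sum_mono:
  assumes "power_sum r a" "r \<le> s"
  shows "power_sum s a"
proof -
  obtain p q where pq: "\<And>i. i \<le> 6 \<Longrightarrow> a i = (\<Sum>j<r. p j ^ (6 - i) * q j ^ i)"
    using assms(1) unfolding power_sum_def by blast
  define p' q' where "p' j = (if j < r then p j else 0)" and "q' j = (if j < r then q j else 0)" for j
  have "a i = (\<Sum>j<s. p' j ^ (6 - i) * q' j ^ i)" if "i \<le> 6" for i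
  proof -
    have "(\<Sum>j<s. p' j ^ (6 - i) * q' j ^ i) = (\<Sum>j<r. p' j ^ (6 - i) * q' j ^ i)"
      using assms(2) that
      by (intro sum.mono_neutral_right) (auto simp: p'_def q'_def)
    also have "\<dots> = a i"
      using pq[OF that] by (simp add: p'_def q'_def)
    finally show ?thesis ..
  qed
  then show ?thesis unfolding power_sum_def by blast
qed

subsection \<open>Invariants under shears and flips\<close>

definition J2 :: "(nat \<Rightarrow> complex) \<Rightarrow> complex" where
  "J2 a = - 10 * (a 3)^2 + 15 * a 2 * a 4 - 6 * a 1 * a 5 + a 0 * a 6"

text \<open>Up to a constant factor the fourth transvectant of the sextic with itself, a quartic
  covariant, in binomially normalized coefficients.\<close>

definition quartic :: "(nat \<Rightarrow> complex) \<Rightarrow> nat \<Rightarrow> complex" where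
  "quartic a i = [6 * (a 0 * a 4 - 4 * a 1 * a 3 + 3 * (a 2)^2),
     3 * (a 0 * a 5 - 3 * a 1 * a 4 + 2 * a 2 * a 3),
     a 0 * a 6 - 9 * a 2 * a 4 + 8 * (a 3)^2,
     3 * (a 1 * a 6 - 3 * a 2 * a 5 + 2 * a 3 * a 4),
     6 * (a 2 * a 6 - 4 * a 3 * a 5 + 3 * (a 4)^2)] ! i"

text \<open>The catalecticant of a quartic, expanded along the first row of its Hankel
  matrix.\<close>

definition hankel3 :: "(nat \<Rightarrow> complex) \<Rightarrow> complex" where
  "hankel3 b = b 0 * (b 2 * b 4 - (b 3)^2) - b 1 * (b 1 * b 4 - b 2 * b 3)
     + b 2 * (b 1 * b 3 - (b 2)^2)"

definition J6 :: "(nat \<Rightarrow> complex) \<Rightarrow> complex" where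
  "J6 a = hankel3 (quartic a)"

lemma det3:
  fixes A :: "'a :: comm_ring_1 mat"
  assumes A: "A \<in> carrier_mat 3 3"
  shows "det A = A $$ (0,0) * (A $$ (1,1) * A $$ (2,2) - A $$ (1,2) * A $$ (2,1))
    - A $$ (0,1) * (A $$ (1,0) * A $$ (2,2) - A $$ (1,2) * A $$ (2,0))
    + A $$ (0,2) * (A $$ (1,0) * A $$ (2,1) - A $$ (1,1) * A $$ (2,0))"
proof -
  have two: "det B = B $$ (0,0) * B $$ (1,1) - B $$ (0,1) * B $$ (1,0)"
    if B: "B \<in> carrier_mat 2 2" for B :: "'a mat"
  proof -
    have del: "mat_delete B 0 j \<in> carrier_mat 1 1" for j
      using mat_delete_carrier[OF B] by simp
    have "det B = (\<Sum>j<2. B $$ (0,j) * cofactor B 0 j)"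
      by (rule laplace_expansion_row[OF B]) simp
    then show ?thesis
      using B by (simp add: numeral_2_eq_2 cofactor_def det_single[OF del]) (simp add: mat_delete_def)
  qed
  have del: "mat_delete A 0 j \<in> carrier_mat 2 2" for j
    using mat_delete_carrier[OF A] by simp
  have "det A = (\<Sum>j<3. A $$ (0,j) * cofactor A 0 j)"
    by (rule laplace_expansion_row[OF A]) simp
  then show ?thesis
    using A by (simp add: numeral_3_eq_3 numeral_2_eq_2 cofactor_def two[OF del, unfolded numeral_2_eq_2])
        (simp add: mat_delete_def algebra_simps)
qed

lemma quartic_values:
  "quartic a 0 = 6 * (a 0 * a 4 - 4 * a 1 * a 3 + 3 * (a 2)^2)"
  "quartic a 1 = 3 * (a 0 * a 5 - 3 * a 1 * a 4 + 2 * a 2 * a 3)"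
  "quartic a 2 = a 0 * a 6 - 9 * a 2 * a 4 + 8 * (a 3)^2"
  "quartic a 3 = 3 * (a 1 * a 6 - 3 * a 2 * a 5 + 2 * a 3 * a 4)"
  "quartic a 4 = 6 * (a 2 * a 6 - 4 * a 3 * a 5 + 3 * (a 4)^2)"
  by (simp_all add: quartic_def)

lemma J2_shear: "J2 (shear t a) = J2 a"
  unfolding J2_def shear_values shear.simps(1)
  by (simp add: algebra_simps power_numeral_reduce)

lemma J2_flip: "J2 (flip a) = J2 a"
  by (simp add: J2_def flip_def algebra_simps)

lemma hankel3_shear: "hankel3 (shear t b) = hankel3 b"
  unfolding hankel3_def shear_values shear.simps(1)
  by (simp add: algebra_simps power_numeral_reduce)

text \<open>Covariance of the quartic splits the invariance of \<open>J6\<close> into two smaller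
  expansions, this one and that of the catalecticant.\<close>

lemma quartic_shear: "i \<le> 4 \<Longrightarrow> quartic (shear t a) i = shear t (quartic a) i"
proof -
  have "quartic (shear t a) 0 = shear t (quartic a) 0" "quartic (shear t a) 1 = shear t (quartic a) 1"
    "quartic (shear t a) 2 = shear t (quartic a) 2" "quartic (shear t a) 3 = shear t (quartic a) 3"
    "quartic (shear t a) 4 = shear t (quartic a) 4"
    unfolding shear_values[of _ "quartic a"] quartic_values shear_values shear.simps(1)
    by (simp_all add: algebra_simps power_numeral_reduce)
  moreover assume "i \<le> 4"
  then have "i = 0 \<or> i = 1 \<or> i = 2 \<or> i = 3 \<or> i = 4" by auto
  ultimately show ?thesis by blast
qed

lemma J6_shear: "J6 (shear t a) = J6 a"
proof -
  have "hankel3 (quartic (shear t a)) = hankel3 (shear t (quartic a))"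
    by (simp add: hankel3_def quartic_shear)
  then show ?thesis by (simp add: J6_def hankel3_shear)
qed

lemma J6_flip: "J6 (flip a) = J6 a"
proof -
  have "quartic (flip a) 0 = quartic a 4" "quartic (flip a) 1 = quartic a 3"
    "quartic (flip a) 2 = quartic a 2" "quartic (flip a) 3 = quartic a 1"
    "quartic (flip a) 4 = quartic a 0"
    unfolding quartic_values by (simp_all add: flip_def mult.commute)
  then show ?thesis
    unfolding J6_def hankel3_def by (simp add: algebra_simps power2_eq_square)
qed

text \<open>Entries, in reversed order, of the Bezout matrix of the partial derivatives divided by 6.
  Indices beyond 5 contribute 0 because of the binomial coefficient.\<close>

definition bezout :: "(nat \<Rightarrow> complex) \<Rightarrow> nat \<Rightarrow> nat \<Rightarrow> complex" where
  "bezout a i j = (\<Sum>k\<le>i.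
       of_nat (5 choose (i - k)) * a (i - k) * (of_nat (5 choose (5 + k - j)) * a (5 + k - j + 1))
     - of_nat (5 choose (i - k)) * a (i - k + 1) * (of_nat (5 choose (5 + k - j)) * a (5 + k - j)))"

definition J10 :: "(nat \<Rightarrow> complex) \<Rightarrow> complex" where
  "J10 a = det (mat 5 5 (\<lambda>(i, j). bezout a i j))"

lemma less_5_cases: "i < 5 \<longleftrightarrow> i = 0 \<or> i = 1 \<or> i = 2 \<or> i = 3 \<or> i = (4 :: nat)"
  by auto

lemma sum_lt_5: "(\<Sum>k = 0..<5 :: nat. f k) = f 0 + f 1 + f 2 + f 3 + (f 4 :: 'a :: comm_monoid_add)"
  by (simp add: eval_nat_numeral ac_simps)

lemma choose_values:
  "5 choose 0 = 1" "5 choose 1 = 5" "5 choose 2 = 10" "5 choose 3 = 10" "5 choose 4 = 5" "5 choose 5 = 1"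
  "5 choose 6 = 0" "5 choose 7 = 0" "5 choose 8 = 0" "5 choose 9 = 0"
  "4 choose 1 = 4" "4 choose 2 = 6" "4 choose 3 = 4"
  "3 choose 1 = 3" "3 choose 2 = 3"  "2 choose 1 = (2::nat)"
  by (simp_all add: eval_nat_numeral)

lemma atMost_numeral:
  "{..1} = {0, 1 :: nat}" "{..2} = {0, 1, 2 :: nat}" "{..3} = {0, 1, 2, 3 :: nat}"
  "{..4} = {0, 1, 2, 3, 4 :: nat}"
  by auto

lemma bezout_values:
  "bezout a 0 0 = 1 * a 0 * a 6 + (-1) * a 1 * a 5"
  "bezout a 0 1 = 5 * a 0 * a 5 + (-5) * a 1 * a 4"
  "bezout a 0 2 = 10 * a 0 * a 4 + (-10) * a 1 * a 3"
  "bezout a 0 3 = 10 * a 0 * a 3 + (-10) * a 1 * a 2"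
  "bezout a 0 4 = 5 * a 0 * a 2 + (-5) * a 1 * a 1"
  "bezout a 1 0 = 5 * a 1 * a 6 + (-5) * a 2 * a 5"
  "bezout a 1 1 = 24 * a 1 * a 5 + (-25) * a 2 * a 4 + 1 * a 0 * a 6"
  "bezout a 1 2 = 45 * a 1 * a 4 + (-50) * a 2 * a 3 + 5 * a 0 * a 5"
  "bezout a 1 3 = 40 * a 1 * a 3 + (-50) * a 2 * a 2 + 10 * a 0 * a 4"
  "bezout a 1 4 = (-10) * a 1 * a 2 + 10 * a 0 * a 3"
  "bezout a 2 0 = 10 * a 2 * a 6 + (-10) * a 3 * a 5"
  "bezout a 2 1 = 45 * a 2 * a 5 + (-50) * a 3 * a 4 + 5 * a 1 * a 6"
  "bezout a 2 2 = 75 * a 2 * a 4 + (-100) * a 3 * a 3 + 24 * a 1 * a 5 + 1 * a 0 * a 6"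
  "bezout a 2 3 = (-50) * a 2 * a 3 + 45 * a 1 * a 4 + 5 * a 0 * a 5"
  "bezout a 2 4 = (-10) * a 1 * a 3 + 10 * a 0 * a 4"
  "bezout a 3 0 = 10 * a 3 * a 6 + (-10) * a 4 * a 5"
  "bezout a 3 1 = 40 * a 3 * a 5 + (-50) * a 4 * a 4 + 10 * a 2 * a 6"
  "bezout a 3 2 = (-50) * a 3 * a 4 + 45 * a 2 * a 5 + 5 * a 1 * a 6"
  "bezout a 3 3 = (-25) * a 2 * a 4 + 24 * a 1 * a 5 + 1 * a 0 * a 6"
  "bezout a 3 4 = (-5) * a 1 * a 4 + 5 * a 0 * a 5"
  "bezout a 4 0 = 5 * a 4 * a 6 + (-5) * a 5 * a 5"
  "bezout a 4 1 = (-10) * a 4 * a 5 + 10 * a 3 * a 6"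
  "bezout a 4 2 = (-10) * a 3 * a 5 + 10 * a 2 * a 6"
  "bezout a 4 3 = (-5) * a 2 * a 5 + 5 * a 1 * a 6"
  "bezout a 4 4 = (-1) * a 1 * a 5 + 1 * a 0 * a 6"
  by (simp_all add: bezout_def atMost_numeral choose_values numeral_2_eq_2[symmetric] algebra_simps)

text \<open>The partial derivatives become f_x and f_y + t f_x, a pair with the same Bezoutian;
  translating its two variables multiplies the matrix on both sides by unitriangular binomial
  matrices. \<open>L\<close> has complemented indices because rows and columns run in opposite
  order.\<close>

lemma J10_shear: "J10 (shear t a) = J10 a"
proof -
  define L where "L = mat 5 5 (\<lambda>(i, j). if j \<le> i then of_nat ((4 - j) choose (4 - i)) * t ^ (i - j) else 0)"
  define R where "R = mat 5 5 (\<lambda>(i, j). if j \<le> i then of_nat (i choose j) * t ^ (i - j) else 0)"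
  define B where "B = mat 5 5 (\<lambda>(i, j). bezout a i j)"
  have carrier: "L \<in> carrier_mat 5 5" "R \<in> carrier_mat 5 5" "B \<in> carrier_mat 5 5"
    by (simp_all add: L_def R_def B_def)
  have "det L = 1"
    by (subst det_lower_triangular[OF _ carrier(1)])
      (auto simp: L_def diag_mat_def intro!: prod_list_neutral)
  moreover have "det R = 1"
    by (subst det_lower_triangular[OF _ carrier(2)])
      (auto simp: R_def diag_mat_def intro!: prod_list_neutral)
  moreover have "mat 5 5 (\<lambda>(i, j). bezout (shear t a) i j) = L * B * R"
  proof (rule eq_matI)
    fix i j assume "i < dim_row (L * B * R)" "j < dim_col (L * B * R)"
    then have ij: "i < 5" "j < 5" using carrier by auto
    have "(L * B * R) $$ (i, j) = (\<Sum>k = 0..<5. L $$ (i, k) * (\<Sum>l = 0..<5. B $$ (k, l) * R $$ (l, j)))"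
      using ij carrier by (simp add: scalar_prod_def)
    moreover have "bezout (shear t a) i j = (\<Sum>k = 0..<5. L $$ (i, k) * (\<Sum>l = 0..<5. B $$ (k, l) * R $$ (l, j)))"
      using ij unfolding less_5_cases sum_lt_5
      apply (elim disjE)
      apply (simp_all only: L_def R_def B_def)
      apply (simp_all add: bezout_values choose_values del: One_nat_def shear.simps(2))
      apply (simp_all only: shear_values shear.simps(1))
      apply (simp_all add: algebra_simps power_numeral_reduce del: One_nat_def shear.simps(2))
      done
    ultimately show "mat 5 5 (\<lambda>(i, j). bezout (shear t a) i j) $$ (i, j) = (L * B * R) $$ (i, j)"
      using ij by simp
  qed (simp_all add: L_def R_def)
  ultimately show ?thesis
    unfolding J10_def B_def[symmetric] using carrier by (simp add: det_mult[of _ 5])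
qed

text \<open>A flip reverses both the rows and the columns of the Bezout matrix, so the sign of the
  reversal cancels.\<close>

lemma J10_flip: "J10 (flip a) = J10 a"
proof -
  define P :: "complex mat" where "P = mat 5 5 (\<lambda>(i, j). if i + j = 4 then 1 else 0)"
  define B where "B = mat 5 5 (\<lambda>(i, j). bezout a i j)"
  have carrier: "P \<in> carrier_mat 5 5" "B \<in> carrier_mat 5 5"
    by (simp_all add: P_def B_def)
  have "P * P = 1\<^sub>m 5"
    by (rule eq_matI) (auto simp: P_def scalar_prod_def sum_lt_5 less_5_cases)
  then have "det P * det P = 1"
    by (metis det_mult[OF carrier(1,1)] det_one)
  moreover have "mat 5 5 (\<lambda>(i, j). bezout (flip a) i j) = P * B * P"
  proof (rule eq_matI)
    fix i j assume "i < dim_row (P * B * P)" "j < dim_col (P * B * P)"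
    then have ij: "i < 5" "j < 5" using carrier by auto
    have "(P * B * P) $$ (i, j) = (\<Sum>k = 0..<5. P $$ (i, k) * (\<Sum>l = 0..<5. B $$ (k, l) * P $$ (l, j)))"
      using ij carrier by (simp add: scalar_prod_def)
    moreover have "bezout (flip a) i j = (\<Sum>k = 0..<5. P $$ (i, k) * (\<Sum>l = 0..<5. B $$ (k, l) * P $$ (l, j)))"
      using ij unfolding less_5_cases sum_lt_5
      apply (elim disjE)
      apply (simp_all only: P_def B_def)
      apply (simp_all add: bezout_values del: One_nat_def)
      apply (simp_all add: flip_def numeral_2_eq_2[symmetric])
      done
    ultimately show "mat 5 5 (\<lambda>(i, j). bezout (flip a) i j) $$ (i, j) = (P * B * P) $$ (i, j)"
      using ij by simp
  qed (simp_all add: P_def)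
  ultimately show ?thesis
    unfolding J10_def B_def[symmetric] using carrier by (simp add: det_mult[of _ 5] mult.commute mult.left_commute)
qed

subsection \<open>Normal forms\<close>

lemma J2_sparse:
  "a 1 = 0 \<Longrightarrow> a 2 = 0 \<Longrightarrow> a 3 = 0 \<Longrightarrow> J2 a = a 0 * a 6"
  by (simp add: J2_def)

lemma J6_sparse:
  "a 1 = 0 \<Longrightarrow> a 2 = 0 \<Longrightarrow> a 3 = 0 \<Longrightarrow> a 4 = 0 \<Longrightarrow> J6 a = - ((a 0 * a 6) ^ 3)"
  unfolding J6_def hankel3_def quartic_values by (simp add: algebra_simps power_numeral_reduce)

text \<open>Apart from the corner (4, 0) the Bezout matrix is upper bidiagonal. Expanding along the
  first column leaves two triangular minors, one with diagonal \<open>a 0 * a 6\<close> and one with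
  diagonal \<open>5 * a 0 * a 5\<close>.\<close>

lemma J10_sparse:
  assumes a: "a 1 = 0" "a 2 = 0" "a 3 = 0" "a 4 = 0"
  shows "J10 a = (a 0 * a 6) ^ 5 - 3125 * a 0 ^ 4 * a 5 ^ 6"
proof -
  define M where "M = mat 5 5 (\<lambda>(i, j). bezout a i j)"
  have M: "M \<in> carrier_mat 5 5" by (simp add: M_def)
  have entry: "bezout a i j = (if j = i then a 0 * a 6 else if j = Suc i then 5 * a 0 * a 5
      else if i = 4 \<and> j = 0 then - 5 * a 5 ^ 2 else 0)" if "i < 5" "j < 5" for i j
    using that unfolding less_5_cases
    by (elim disjE) (simp_all add: bezout_values[unfolded One_nat_def] a a(1)[simplified] power2_eq_square)
  have "det M = (\<Sum>i<5. M $$ (i, 0) * cofactor M i 0)"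
    by (rule laplace_expansion_column[OF M]) simp
  also have "\<dots> = a 0 * a 6 * cofactor M 0 0 - 5 * a 5 ^ 2 * cofactor M 4 0"
    by (simp add: lessThan_atLeast0 sum_lt_5 M_def entry)
  also have "cofactor M 0 0 = (a 0 * a 6) ^ 4"
  proof -
    have "det (mat_delete M 0 0) = prod_list (diag_mat (mat_delete M 0 0))"
      by (rule det_upper_triangular[of _ 4])
        (auto simp: M_def mat_delete_def entry)
    also have "\<dots> = (a 0 * a 6) ^ 4"
      by (simp add: prod_list_diag_prod mat_delete_def M_def entry)
    finally show ?thesis by (simp add: cofactor_def)
  qed
  also have "cofactor M 4 0 = (5 * a 0 * a 5) ^ 4"
  proof -
    have "det (mat_delete M 4 0) = prod_list (diag_mat (mat_delete M 4 0))"
      by (rule det_lower_triangular[of 4])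
        (auto simp: M_def mat_delete_def entry)
    also have "\<dots> = (5 * a 0 * a 5) ^ 4"
      by (simp add: prod_list_diag_prod mat_delete_def M_def entry)
    finally show ?thesis by (simp add: cofactor_def)
  qed
  finally show ?thesis
    unfolding J10_def M_def[symmetric] by (simp add: algebra_simps power_numeral_reduce)
qed

text \<open>The middle coefficient of the covariant quartic equals \<open>J2 a\<close>, so its cube
  cancels in the sum. All remaining terms share the factor \<open>54 * r^2 * y^2 * w * s\<close>,
  and the cofactor is again \<open>w * s\<close>.\<close>

lemma J2_J6_geometric:
  assumes "a 2 = r * a 1" "a 3 = r^2 * a 1" "a 4 = r^3 * a 1" "a 5 = r^4 * a 1"
  shows "J2 a ^ 3 + J6 a = 54 * r^2 * a 1 ^ 2 * (r * a 0 - a 1) ^ 2 * (a 6 - r^5 * a 1) ^ 2"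
proof -
  define x y z w s where "x = a 0" and "y = a 1" and "z = a 6" and "w = r * x - y"
    and "s = z - r ^ 5 * y"
  note xyz = assms x_def[symmetric] y_def[symmetric] z_def[symmetric]
  have b: "quartic a 0 = 6 * r^2 * y * w" "quartic a 1 = 3 * r^3 * y * w"
    "quartic a 2 = J2 a" "quartic a 3 = 3 * y * s" "quartic a 4 = 6 * r * y * s"
    unfolding quartic_values J2_def xyz w_def s_def
    by (simp_all add: algebra_simps power_numeral_reduce)
  have "r * J2 a - y * s - r ^ 5 * y * w = w * s"
    unfolding J2_def xyz w_def s_def
    by (simp add: algebra_simps power_numeral_reduce)
  moreover have "J2 a ^ 3 + J6 a = 54 * r^2 * y^2 * w * s * (r * J2 a - y * s - r ^ 5 * y * w)"
    unfolding J6_def hankel3_def b by (simp add: algebra_simps power_numeral_reduce)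
  ultimately show ?thesis
    by (simp add: x_def y_def z_def w_def s_def power2_eq_square ac_simps)
qed

section \<open>Triple roots and sums of at most two powers\<close>

lemma contract_funpow_zero:
  "(\<And>i. i \<le> n + k \<Longrightarrow> a i = 0) \<Longrightarrow> (contract u v ^^ n) a k = 0"
proof (induction n arbitrary: k)
  case (Suc n)
  have "(contract u v ^^ n) a k = 0" "(contract u v ^^ n) a (Suc k) = 0"
    by (rule Suc.IH; simp add: Suc.prems)+
  then show ?case by (simp add: contract_def[of u v _ k])
qed simp

text \<open>Derivatives of the zero form vanish, so it is enough that some number of contractions up
  to four kills the form.\<close>

lemma triple_rootI:
  assumes "(u, v) \<noteq> (0, 0)" "m \<le> 4" "\<And>i. i \<le> 6 - m \<Longrightarrow> (contract u v ^^ m) a i = 0"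
  shows "triple_root a"
proof -
  have "(contract u v ^^ 4) a k = 0" if "k \<le> 2" for k
  proof -
    have "(contract u v ^^ 4) a k = (contract u v ^^ (4 - m)) ((contract u v ^^ m) a) k"
      using assms(2) by (simp flip: funpow_add comp_apply[of "contract u v ^^ (4 - m)" "contract u v ^^ m"])
    also have "\<dots> = 0"
      by (rule contract_funpow_zero) (use that assms in auto)
    finally show ?thesis .
  qed
  with assms(1) show ?thesis unfolding triple_root_def by blast
qed

text \<open>If the two linear forms are proportional, a single first-order operator kills both
  powers.\<close>

lemma power_sum_2_proportional:
  assumes "p * q' = p' * q" "\<And>i. i \<le> 6 \<Longrightarrow> a i = p ^ (6 - i) * q ^ i + p' ^ (6 - i) * q' ^ i"
  shows "triple_root a"
proof -
  have kill: "u * (p ^ (6 - Suc i) * q ^ Suc i) = v * (p ^ (6 - i) * q ^ i)"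
    if "u * q = v * p" "i \<le> 5" for u v p q :: complex and i
  proof -
    have "6 - i = Suc (6 - Suc i)" using that(2) by simp
    then show ?thesis using that(1) by (simp add: algebra_simps)
  qed
  \<comment> \<open>The point comes from whichever linear form is nonzero; if both vanish, any point
    serves.\<close>
  obtain u v where uv: "(u, v) \<noteq> (0, 0)" "u * q = v * p" "u * q' = v * p'"
  proof (cases "(p, q) = (0, 0)")
    case True
    then show ?thesis
      using that[of p' q'] that[of 1 0] by (cases "(p', q') = (0, 0)") (auto simp: mult.commute)
  next
    case False
    then show ?thesis using that[of p q] assms(1) by (auto simp: mult.commute)
  qed
  show ?thesis
  proof (rule triple_rootI[OF uv(1), of 1])
    fix i :: nat assume "i \<le> 6 - 1"
    then have i: "i \<le> 5" "i \<le> 6" "Suc i \<le> 6" by auto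
    have "(contract u v ^^ 1) a i = v * a i - u * a (Suc i)" by (simp add: contract_def)
    also have "\<dots> = 0"
      by (simp only: assms(2)[OF i(2)] assms(2)[OF i(3)] distrib_left
          kill[OF uv(2) i(1)] kill[OF uv(3) i(1)] diff_self)
    finally show "(contract u v ^^ 1) a i = 0" .
  qed simp
qed

lemma power_sum_1_triple_root: "power_sum 1 a \<Longrightarrow> triple_root a"
proof -
  assume "power_sum 1 a"
  then obtain p q where pq: "\<And>i. i \<le> 6 \<Longrightarrow> a i = p ^ (6 - i) * q ^ i"
    unfolding power_sum_def by auto
  have "contract p q a i = 0" if "i \<le> 5" for i
    using contract_power[of i 6 p q] that pq[of i] pq[of "Suc i"] by (simp add: contract_def)
  moreover have "a i = 0" if "i \<le> 6" "(p, q) = (0, 0)" for i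
    using pq[OF that(1)] that by (cases "i = 0") auto
  ultimately show ?thesis
    using triple_rootI[of p q 1 a] triple_rootI[of 1 1 0 a] by (cases "(p, q) = (0, 0)") auto
qed

section \<open>Weighted powers, splitting of operators and interpolation\<close>

lemma power_sum_weighted:
  assumes "\<And>i. i \<le> 6 \<Longrightarrow> a i = (\<Sum>j<r. d j * p j ^ (6 - i) * q j ^ i)"
  shows "power_sum r a"
proof -
  \<comment> \<open>Sixth roots of the weights are absorbed into the linear forms.\<close>
  have "\<forall>j. \<exists>z. z ^ 6 = d j"
    using nth_root_exists[of 6] by auto
  then obtain z where z: "z j ^ 6 = d j" for j by metis
  have "a i = (\<Sum>j<r. (z j * p j) ^ (6 - i) * (z j * q j) ^ i)" if "i \<le> 6" for i
  proof -
    have "z j ^ (6 - i) * z j ^ i = d j" for j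
      using that z[of j] by (simp flip: power_add)
    then have "(z j * p j) ^ (6 - i) * (z j * q j) ^ i = d j * p j ^ (6 - i) * q j ^ i" for j
      by (simp add: power_mult_distrib ac_simps)
    then show ?thesis using assms[OF that] by simp
  qed
  then show ?thesis unfolding power_sum_def
    by (rule_tac x = "\<lambda>j. z j * p j" in exI, rule_tac x = "\<lambda>j. z j * q j" in exI) simp
qed

text \<open>This says c0 + c1 X + c2 X^2 = (v1 - u1 X) (v2 - u2 X), where X stands for the index
  shift and v - u X for \<open>contract u v\<close>. A vanishing leading coefficient is a root at
  infinity, a factor with u = 0.\<close>

lemma quadratic_splits:
  fixes c0 c1 c2 :: complex
  obtains u1 v1 u2 v2 where "c0 = v1 * v2" "c1 = - (u1 * v2 + u2 * v1)" "c2 = u1 * u2"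
proof (cases "c2 = 0")
  case True
  then show ?thesis using that[of 1 c0 0 "- c1"] by simp
next
  case False
  then have "\<not> constant (poly [:c0, c1, c2:])"
    by (simp add: constant_degree)
  then obtain r where "poly [:c0, c1, c2:] r = 0"
    using fundamental_theorem_of_algebra by blast
  then have "c0 + r * (c1 + r * c2) = 0" by simp
  then have "c0 = - (r * (c1 + r * c2))" by (simp only: eq_neg_iff_add_eq_0)
  then have "c0 = - (c1 + c2 * r) * r" by (simp add: algebra_simps)
  then show ?thesis using that[of "- (c1 + c2 * r)" r c2 1] by (simp add: algebra_simps)
qed

lemma cubic_splits:
  fixes c0 c1 c2 c3 :: complex
  obtains u1 v1 u2 v2 u3 v3 where "c0 = v1 * v2 * v3"
    "c1 = - (u1 * v2 * v3 + v1 * u2 * v3 + v1 * v2 * u3)"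
    "c2 = u1 * u2 * v3 + u1 * v2 * u3 + v1 * u2 * u3" "c3 = - (u1 * u2 * u3)"
proof (cases "c3 = 0")
  case True
  obtain u1 v1 u2 v2 where "c0 = v1 * v2" "c1 = - (u1 * v2 + u2 * v1)" "c2 = u1 * u2"
    by (rule quadratic_splits)
  then show ?thesis using that[of v1 v2 1 u1 u2 0] True by (simp add: algebra_simps)
next
  case False
  then have "\<not> constant (poly [:c0, c1, c2, c3:])"
    by (simp add: constant_degree)
  then obtain r where "poly [:c0, c1, c2, c3:] r = 0"
    using fundamental_theorem_of_algebra by blast
  then have "c0 + r * (c1 + r * (c2 + r * c3)) = 0" by simp
  then have "c0 = - (r * (c1 + r * (c2 + r * c3)))"
    by (simp only: eq_neg_iff_add_eq_0)
  also have "\<dots> = r * (r * (- r * c3 - c2) - c1)" by (simp add: algebra_simps)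
  finally have r: "c0 = r * (r * (- r * c3 - c2) - c1)" .
  \<comment> \<open>The quotient of the cubic by r - X is A + B X - c3 X^2.\<close>
  define A B where "A = r * (- r * c3 - c2) - c1" and "B = - r * c3 - c2"
  obtain u1 v1 u2 v2 where AB: "A = v1 * v2" "B = - (u1 * v2 + u2 * v1)" "- c3 = u1 * u2"
    by (rule quadratic_splits)
  have "c0 = r * A" "c1 = r * B - A" "c2 = r * (- c3) - B" "c3 = - (- c3)"
    using r by (simp_all add: A_def B_def algebra_simps)
  note c = this[unfolded AB]
  show ?thesis
    by (rule that[of v1 v2 r u1 u2 1]; rule c[THEN trans]; simp add: algebra_simps)
qed


text \<open>Since \<open>contract 1 w\<close> is w minus the index shift, the hypothesis is a linear
  recurrence with distinct characteristic roots, whose solutions are sums of geometric sequences.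
  Each root extends the range by one index.\<close>

lemma interpolation:
  assumes "distinct zs" "\<And>i. i < m \<Longrightarrow> fold (contract 1) zs a i = 0"
  shows "\<exists>d. \<forall>i < m + length zs. a i = (\<Sum>w\<in>set zs. d w * w ^ i)"
  using assms
proof (induction zs arbitrary: a)
  case (Cons z zs)
  have "\<exists>d. \<forall>i < m + length zs. contract 1 z a i = (\<Sum>w\<in>set zs. d w * w ^ i)"
    by (rule Cons.IH) (use Cons.prems in simp_all)
  then obtain d where d: "\<And>i. i < m + length zs \<Longrightarrow> contract 1 z a i = (\<Sum>w\<in>set zs. d w * w ^ i)"
    by blast
  have z: "z \<notin> set zs" using Cons.prems by simp
  \<comment> \<open>\<open>contract 1 z\<close> multiplies the sequence \<open>w ^ i\<close> by z -
    w. Dividing the weights by z - w thus gives a particular solution \<open>s\<close>, and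
    \<open>a - s\<close> is geometric with ratio z.\<close>
  define e where "e w = d w / (z - w)" for w
  define s where "s i = (\<Sum>w\<in>set zs. e w * w ^ i)" for i
  have step: "a (Suc i) - s (Suc i) = z * (a i - s i)" if "i < m + length zs" for i
  proof -
    have "z * (e w * w ^ i) - e w * w ^ Suc i = d w * w ^ i" if "w \<in> set zs" for w
    proof -
      have "(z - w) * e w = d w" using z that by (auto simp: e_def)
      moreover have "z * (e w * w ^ i) - e w * w ^ Suc i = (z - w) * e w * w ^ i"
        by (simp add: algebra_simps)
      ultimately show ?thesis by simp
    qed
    then have "(\<Sum>w\<in>set zs. z * (e w * w ^ i) - e w * w ^ Suc i) = (\<Sum>w\<in>set zs. d w * w ^ i)"
      by (intro sum.cong) auto
    then have "z * s i - s (Suc i) = (\<Sum>w\<in>set zs. d w * w ^ i)"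
      unfolding s_def sum_distrib_left sum_subtractf .
    then show ?thesis using d[OF that] by (simp add: contract_def algebra_simps)
  qed
  have rest: "a i - s i = (a 0 - s 0) * z ^ i" if "i < m + length (z # zs)" for i
    using that
  proof (induction i)
    case (Suc i)
    then show ?case using step[of i] by (simp add: ac_simps)
  qed simp
  have "a i = (\<Sum>w\<in>set (z # zs). (if w = z then a 0 - s 0 else e w) * w ^ i)"
    if "i < m + length (z # zs)" for i
  proof -
    have "(\<Sum>w\<in>set zs. (if w = z then a 0 - s 0 else e w) * w ^ i) = s i"
      unfolding s_def by (rule sum.cong) (use z in auto)
    then show ?thesis using rest[OF that] z by (simp add: algebra_simps)
  qed
  then show ?case
    by (intro exI[of _ "\<lambda>w. if w = z then a 0 - s 0 else e w"] allI impI)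
qed simp

lemma power_sum_interpolation:
  assumes "distinct zs" "m + length zs = 7" "\<And>i. i < m \<Longrightarrow> fold (contract 1) zs a i = 0"
  shows "power_sum (length zs) a"
proof -
  have "\<exists>d. \<forall>i < 7. a i = (\<Sum>w\<in>set zs. d w * w ^ i)"
    using interpolation[OF assms(1), of m a] assms(2,3) by simp
  then obtain d where d: "\<And>i. i < 7 \<Longrightarrow> a i = (\<Sum>w\<in>set zs. d w * w ^ i)"
    by blast
  show ?thesis
  proof (rule power_sum_weighted)
    fix i :: nat assume "i \<le> 6"
    have "(\<Sum>w\<in>set zs. d w * w ^ i) = (\<Sum>j<length zs. d (zs ! j) * (zs ! j) ^ i)"
      by (rule sum.reindex_bij_betw[symmetric]) (use bij_betw_nth[OF assms(1)] in simp)
    then show "a i = (\<Sum>j<length zs. d (zs ! j) * 1 ^ (6 - i) * (zs ! j) ^ i)"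
      using d[of i] \<open>i \<le> 6\<close> by simp
  qed
qed

text \<open>The three cases of the theorem in terms of quantities stable under shears and flips. In
  the last one \<open>J10 a \<noteq> J2 a ^ 5\<close> covers both kinds of weighted point: it means
  \<open>J10 a \<noteq> 0\<close> if \<open>J2 a = 0\<close>, and a last coordinate other than 1
  otherwise.\<close>

definition classified :: "(nat \<Rightarrow> complex) \<Rightarrow> bool" where
  "classified a \<longleftrightarrow>
     J2 a ^ 3 + J6 a \<noteq> 0 \<and> power_sum 3 a \<and> \<not> power_sum 2 a \<or>
     J2 a ^ 3 + J6 a = 0 \<and> power_sum 2 a \<and> \<not> power_sum 1 a \<and> J2 a \<noteq> 0 \<and> J10 a = J2 a ^ 5 \<or>
     J2 a ^ 3 + J6 a = 0 \<and> power_sum 5 a \<and> \<not> power_sum 4 a \<and> J10 a \<noteq> J2 a ^ 5"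

lemma classified_shear: "classified (shear t a) \<longleftrightarrow> classified a"
  by (simp add: classified_def J2_shear J6_shear J10_shear power_sum_shear)

lemma classified_flip: "classified (flip a) \<longleftrightarrow> classified a"
  by (simp add: classified_def J2_flip J6_flip J10_flip power_sum_flip)

text \<open>A shear followed by a flip moves the first point to \<open>(0 : 1)\<close>, and a further shear fixes it
  and moves the second one to \<open>(1 : 0)\<close>.\<close>

lemma normalize_two_points:
  assumes "u1 * v2 \<noteq> u2 * v1" and "R a u1 v1 u2 v2"
    and shear: "\<And>a u1 v1 u2 v2 t. R a u1 v1 u2 v2 \<Longrightarrow> R (shear t a) u1 (v1 + t * u1) u2 (v2 + t * u2)"
    and flip: "\<And>a u1 v1 u2 v2. R a u1 v1 u2 v2 \<Longrightarrow> R (flip a) v1 u1 v2 u2"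
    and base: "\<And>a v u. v \<noteq> 0 \<Longrightarrow> u \<noteq> 0 \<Longrightarrow> \<not> triple_root a \<Longrightarrow> R a 0 v u 0 \<Longrightarrow> classified a"
    and "\<not> triple_root a"
  shows "classified a"
proof -
  have step: "classified a" if "R a 0 v u w" "v \<noteq> 0" "u \<noteq> 0" "\<not> triple_root a" for a v u w
  proof -
    have "R (shear (- w / u) a) 0 v u 0"
      using shear[OF that(1), of "- w / u"] that(3) by simp
    then have "classified (shear (- w / u) a)"
      using base[of v u "shear (- w / u) a"] that by (simp add: triple_root_shear)
    then show ?thesis by (simp add: classified_shear)
  qed
  show ?thesis
  proof (cases "u1 = 0")
    case True
    then show ?thesis using step[of a v1 u2 v2] assms(1,2,6) by auto
  next
    case False
    let ?t = "- v1 / u1"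
    have "R (flip (shear ?t a)) 0 u1 (v2 + ?t * u2) u2"
      using flip[OF shear[OF assms(2), of ?t]] False by simp
    moreover have "v2 + ?t * u2 \<noteq> 0"
      using assms(1) False by (auto simp: field_simps)
    ultimately have "classified (flip (shear ?t a))"
      using step[of "flip (shear ?t a)" u1 "v2 + ?t * u2" u2] False assms(6)
      by (simp add: triple_root_flip triple_root_shear)
    then show ?thesis by (simp add: classified_shear classified_flip)
  qed
qed

lemma le_3_cases: "i \<le> 3 \<longleftrightarrow> i = 0 \<or> i = 1 \<or> i = 2 \<or> i = (3::nat)"
  and le_4_cases: "i \<le> 4 \<longleftrightarrow> i = 0 \<or> i = 1 \<or> i = 2 \<or> i = 3 \<or> i = (4::nat)"
  by auto

lemma contract_scale: "contract (k * u) (k * v) a = (\<lambda>i. k * contract u v a i)"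
  unfolding contract_def fun_eq_iff by (simp add: algebra_simps)

lemma contract_scale_arg: "contract u v (\<lambda>i. k * a i) = (\<lambda>i. k * contract u v a i)"
  unfolding contract_def fun_eq_iff by (simp add: algebra_simps)

text \<open>One contraction of a reversed sequence; \<open>k\<close> carries the sign collected so
  far, so that contractions at different points can be reflected one after another.\<close>

lemma contract_reflect:
  assumes "i \<le> n" "b i = k * a (Suc n - i)" "b (Suc i) = k * a (Suc n - Suc i)"
  shows "contract v u b i = - k * contract u v a (n - i)"
proof -
  have "Suc n - i = Suc (n - i)" using assms(1) by simp
  then show ?thesis using assms by (simp add: contract_def[of _ _ b] contract_def[of _ _ a] algebra_simps)
qed

lemma contract1_flip:
  "i \<le> 5 \<Longrightarrow> contract v1 u1 (flip a) i = -1 * contract u1 v1 a (5 - i)"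
  using contract_reflect[of i 5 "flip a" 1 a] by (simp add: flip_def)

lemma contract2_flip:
  "i \<le> 4 \<Longrightarrow> contract v1 u1 (contract v2 u2 (flip a)) i = contract u1 v1 (contract u2 v2 a) (4 - i)"
  using contract_reflect[of i 4 "contract v2 u2 (flip a)" "-1" "contract u2 v2 a"]
    contract1_flip[of i v2 u2 a] contract1_flip[of "Suc i" v2 u2 a] by simp

lemma contract3_flip:
  "i \<le> 3 \<Longrightarrow> contract v1 u1 (contract v2 u2 (contract v3 u3 (flip a))) i
    = - contract u1 v1 (contract u2 v2 (contract u3 v3 a)) (3 - i)"
  using contract_reflect[of i 3 "contract v2 u2 (contract v3 u3 (flip a))" 1 "contract u2 v2 (contract u3 v3 a)"]
    contract2_flip[of i v2 u2 v3 u3 a] contract2_flip[of "Suc i" v2 u2 v3 u3 a] by simp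

section \<open>Classification of the normal forms\<close>

lemma le_6_cases:
  "i \<le> 6 \<longleftrightarrow> i = 0 \<or> i = 1 \<or> i = 2 \<or> i = 3 \<or> i = 4 \<or> i = 5 \<or> i = (6::nat)"
  by auto

lemma sum_lt_2: "(\<Sum>j<2 :: nat. f j) = f 0 + (f 1 :: 'a :: comm_monoid_add)"
  and sum_lt_3: "(\<Sum>j<3 :: nat. f j) = f 0 + f 1 + (f 2 :: 'a :: comm_monoid_add)"
  and sum_lt_4: "(\<Sum>j<4 :: nat. f j) = f 0 + f 1 + f 2 + (f 3 :: 'a :: comm_monoid_add)"
  by (simp_all add: eval_nat_numeral)

lemma power_sum_2I:
  assumes "\<And>i. i \<le> 6 \<Longrightarrow> a i = d * p ^ (6 - i) * q ^ i + d' * p' ^ (6 - i) * q' ^ i"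
  shows "power_sum 2 a"
proof (rule power_sum_weighted)
  fix i :: nat assume "i \<le> 6"
  then show "a i = (\<Sum>j<2 :: nat. (if j = 0 then d else d') * (if j = 0 then p else p') ^ (6 - i)
      * (if j = 0 then q else q') ^ i)"
    unfolding sum_lt_2 by (subst assms) auto
qed

lemma power_sum_3I:
  assumes "\<And>i. i \<le> 6 \<Longrightarrow> a i = d * p ^ (6 - i) * q ^ i + d' * p' ^ (6 - i) * q' ^ i
     + d'' * p'' ^ (6 - i) * q'' ^ i"
  shows "power_sum 3 a"
proof (rule power_sum_weighted)
  fix i :: nat assume "i \<le> 6"
  then show "a i = (\<Sum>j<3 :: nat. (if j = 0 then d else if j = 1 then d' else d'')
      * (if j = 0 then p else if j = 1 then p' else p'') ^ (6 - i)
      * (if j = 0 then q else if j = 1 then q' else q'') ^ i)"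
    unfolding sum_lt_3 by (subst assms) auto
qed

text \<open>Without a triple root the two linear forms are independent, so the operators killing
  them can be normalized to multiples of \<partial>/\<partial>x and \<partial>/\<partial>y. What
  remains is \<open>a 0\<close> x^6 + \<open>a 6\<close> y^6, where a vanishing coefficient would
  again give a triple root.\<close>

lemma two_powers_classified:
  assumes "power_sum 2 a" and stable: "\<not> triple_root a"
  shows "classified a"
proof -
  obtain P Q where "\<forall>i\<le>6. a i = (\<Sum>j<2 :: nat. P j ^ (6 - i) * Q j ^ i)"
    using assms(1) unfolding power_sum_def by blast
  then obtain p q p' q' where a: "\<And>i. i \<le> 6 \<Longrightarrow> a i = p ^ (6 - i) * q ^ i + p' ^ (6 - i) * q' ^ i"
    using that[of "P 0" "Q 0" "P 1" "Q 1"] unfolding sum_lt_2 by blast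
  have ne: "p * q' \<noteq> p' * q"
    using power_sum_2_proportional a stable by blast
  have kill: "q * (p ^ (6 - i) * q ^ i) = p * (p ^ (6 - Suc i) * q ^ Suc i)" if "i \<le> 5"
    for p q :: complex and i
    using contract_power[of i 6 p q] that by (simp add: contract_def)
  define R where "R a u1 v1 u2 v2 \<longleftrightarrow> (\<forall>i\<le>4. contract u1 v1 (contract u2 v2 a) i = 0)"
    for a u1 v1 u2 v2
  have "R a p q p' q'"
    unfolding R_def
  proof (intro allI impI)
    fix i :: nat assume i: "i \<le> 4"
    define x y where "x i = p ^ (6 - i) * q ^ i" and "y i = p' ^ (6 - i) * q' ^ i" for i
    have "contract p q (contract p' q' a) i = q' * (q * x i - p * x (Suc i))
        - p' * (q * x (Suc i) - p * x (Suc (Suc i))) + q * (q' * y i - p' * y (Suc i))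
        - p * (q' * y (Suc i) - p' * y (Suc (Suc i)))"
      using a[of i] a[of "Suc i"] a[of "Suc (Suc i)"] i
      unfolding x_def[symmetric] y_def[symmetric] by (simp add: contract_def algebra_simps)
    also have "\<dots> = 0"
    proof -
      have "q * x j = p * x (Suc j)" "q' * y j = p' * y (Suc j)" if "j \<le> 5" for j
        using that unfolding x_def y_def by (rule kill)+
      then show ?thesis using i by simp
    qed
    finally show "contract p q (contract p' q' a) i = 0" .
  qed
  with ne show ?thesis
  proof (rule normalize_two_points[where R = R])
    fix a u1 v1 u2 v2 t assume "R a u1 v1 u2 v2"
    then show "R (shear t a) u1 (v1 + t * u1) u2 (v2 + t * u2)"
      by (auto simp: R_def contract_shear intro!: shear_zero)
  next
    fix a u1 v1 u2 v2 assume "R a u1 v1 u2 v2"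
    then show "R (flip a) v1 u1 v2 u2"
      by (auto simp: R_def contract2_flip)
  next
    fix a :: "nat \<Rightarrow> complex" and u v
    assume "v \<noteq> 0" "u \<noteq> 0" and stable: "\<not> triple_root a" and "R a 0 v u 0"
    then have suc: "a (Suc i) = 0" if "i \<le> 4" for i
      using that by (auto simp: R_def contract_def)
    have zero: "a i = 0" if "1 \<le> i" "i \<le> 5" for i
      using suc[of "i - 1"] that by simp
    have a: "a 1 = 0" "a 2 = 0" "a 3 = 0" "a 4 = 0" "a 5 = 0"
      by (rule zero; simp)+
    have "a 0 \<noteq> 0"
    proof
      assume "a 0 = 0"
      then have "a i = 0" if "i \<le> 5" for i using zero[of i] that by (cases "i = 0") auto
      then show False using triple_rootI[of 0 1 1 a] stable by (simp add: contract_def)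
    qed
    moreover have "a 6 \<noteq> 0"
    proof
      assume "a 6 = 0"
      then have "a (Suc i) = 0" if "i \<le> 5" for i using zero[of "Suc i"] that by (cases "i = 5") auto
      then show False using triple_rootI[of 1 0 1 a] stable by (simp add: contract_def)
    qed
    moreover have "power_sum 2 a"
      by (rule power_sum_2I[of _ "a 0" 1 0 "a 6" 0 1]) (use a in \<open>auto simp: le_6_cases\<close>)
    moreover have "\<not> power_sum 1 a"
      using power_sum_1_triple_root stable by blast
    ultimately show "classified a"
      using a by (simp add: classified_def J2_sparse J6_sparse J10_sparse)
  qed (rule stable)
qed

text \<open>For \<open>S = a\<^sub>6/a\<^sub>5\<close> and \<open>R = a\<^sub>5/a\<^sub>0\<close>, the quintic operator with these five roots annihilates
  \<open>a\<^sub>0 x\<^sup>6 + 6 a\<^sub>5 x y\<^sup>5 + a\<^sub>6 y\<^sup>6\<close>. All but finitely many \<open>t\<close> work.\<close>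

lemma ex_five_points:
  fixes S R :: complex
  assumes "R \<noteq> 0"
  obtains t x y where "distinct [t, - t, 1, x, y]" "x + y = S - 1" "- (t^2 * (x * y)) = R"
proof -
  \<comment> \<open>The roots of the factors are the values of t where two points collide or t is 0:
    in order t = 0, t = \<plusminus>1, x = y, and one of x, y equal to t, to -t, to 1.\<close>
  define P where "P = [:0, 1:] * [:-1, 0, 1:] * [:4 * R, 0, (S - 1)^2:] * [:- R, 0, 0, - (S - 1), 1:]
    * [:- R, 0, 0, S - 1, 1:] * [:- R, 0, 2 - S:]"
  have "P \<noteq> 0" using assms by (simp add: P_def)
  then have "\<exists>t. t \<notin> {t. poly P t = 0}"
    using ex_new_if_finite[OF infinite_UNIV_char_0] poly_roots_finite by metis
  then obtain t where "poly P t \<noteq> 0" by auto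
  then have "poly [:0, 1:] t \<noteq> 0" "poly [:-1, 0, 1:] t \<noteq> 0" "poly [:4 * R, 0, (S - 1)^2:] t \<noteq> 0"
    "poly [:- R, 0, 0, - (S - 1), 1:] t \<noteq> 0" "poly [:- R, 0, 0, S - 1, 1:] t \<noteq> 0"
    "poly [:- R, 0, 2 - S:] t \<noteq> 0"
    unfolding P_def poly_mult mult_eq_0_iff by blast+
  then have t: "t \<noteq> 0" "t * t \<noteq> 1" "4 * R + t * (t * (S - 1)^2) \<noteq> 0"
    "- R + t * (t * (t * (1 - S + t))) \<noteq> 0" "- R + t * (t * (t * (S - 1 + t))) \<noteq> 0"
    "- R + t * (t * (2 - S)) \<noteq> 0"
    by simp_all
  \<comment> \<open>x and y will be the roots of w^2 - (S - 1) w - R / t^2, and \<open>s\<close> is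
    a square root of its discriminant.\<close>
  define s where "s = csqrt ((S - 1)^2 + 4 * R / t^2)"
  have s: "s^2 = (S - 1)^2 + 4 * R / t^2" by (simp add: s_def)
  define x y where "x = ((S - 1) + s) / 2" and "y = ((S - 1) - s) / 2"
  have sum: "x + y = S - 1" by (simp add: x_def y_def field_simps)
  have "4 * (x * y) = (S - 1)^2 - s^2" by (simp add: x_def y_def field_simps power2_eq_square)
  then have "4 * (x * y) = 4 * (- (R / t^2))" unfolding s by simp
  then have "x * y = - (R / t^2)" unfolding mult_cancel_left by simp
  then have prod: "- (t^2 * (x * y)) = R" using t(1) by simp
  have root: "R = w * w * (t * t) - (S - 1) * w * (t * t)" if "w = x \<or> w = y" for w
  proof -
    have "x * x = (S - 1) * x - x * y" "y * y = (S - 1) * y - x * y"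
      unfolding sum[symmetric] by (simp_all add: algebra_simps)
    then have "w * w = (S - 1) * w - x * y" using that by auto
    then have w: "w * w - (S - 1) * w = - (x * y)" by simp
    have "w * w * (t * t) - (S - 1) * w * (t * t) = (w * w - (S - 1) * w) * (t * t)"
      by (simp add: algebra_simps)
    also have "\<dots> = - (t^2 * (x * y))" unfolding w by (simp add: power2_eq_square)
    finally show ?thesis unfolding prod by simp
  qed
  have "w \<noteq> t" "w \<noteq> - t" "w \<noteq> 1" if "w = x \<or> w = y" for w
  proof -
    have "- R + t * (t * (t * (1 - S + t))) = 0" if "R = t * t * (t * t) - (S - 1) * t * (t * t)"
      unfolding that by (simp add: algebra_simps)
    moreover have "- R + t * (t * (t * (S - 1 + t))) = 0"
      if "R = (- t) * (- t) * (t * t) - (S - 1) * (- t) * (t * t)"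
      unfolding that by (simp add: algebra_simps)
    moreover have "- R + t * (t * (2 - S)) = 0" if "R = 1 * 1 * (t * t) - (S - 1) * 1 * (t * t)"
      unfolding that by (simp add: algebra_simps)
    ultimately show "w \<noteq> t" "w \<noteq> - t" "w \<noteq> 1" using root[OF that] t by metis+
  qed
  moreover have "x \<noteq> y"
  proof
    assume "x = y"
    then have "s = 0" by (simp add: x_def y_def field_simps)
    then have "0 = t^2 * ((S - 1)^2 + 4 * R / t^2)" using s by simp
    also have "\<dots> = 4 * R + t * (t * (S - 1)^2)"
      using t(1) by (simp add: field_simps power2_eq_square)
    finally show False using t(3) by simp
  qed
  moreover have "t \<noteq> - t" "t \<noteq> 1"
    using t(1,2) by (auto simp: eq_neg_iff_add_eq_0)
  moreover have "- t \<noteq> 1"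
  proof
    assume eq: "- t = 1"
    have "t * t = (- t) * (- t)" by simp
    also have "\<dots> = 1" unfolding eq by simp
    finally show False using t(2) by simp
  qed
  ultimately show ?thesis using that[of t x y] sum prod by auto
qed

text \<open>Five points leave two equations. As \<open>a 1\<close> to \<open>a 4\<close> vanish,
  these involve only the product and the sum of the points, which are prescribed to be
  \<open>a 5 / a 0\<close> and \<open>a 6 / a 5\<close>.\<close>

lemma power_sum_5_sparse:
  assumes a: "a 1 = 0" "a 2 = 0" "a 3 = 0" "a 4 = 0" and "a 0 \<noteq> 0" "a 5 \<noteq> 0"
  shows "power_sum 5 a"
proof -
  obtain t x y where t: "distinct [t, - t, 1, x, y]" "x + y = a 6 / a 5 - 1"
    "- (t^2 * (x * y)) = a 5 / a 0"
    using ex_five_points[of "a 5 / a 0" "a 6 / a 5"] assms by auto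
  have "fold (contract 1) [t, - t, 1, x, y] a i = 0" if "i < 2" for i
  proof -
    have "i = 0 \<or> i = 1" using that by auto
    moreover have "fold (contract 1) [t, - t, 1, x, y] a 0 = - (t^2 * (x * y)) * a 0 - a 5"
      using a by (simp add: contract_def algebra_simps power2_eq_square numeral_2_eq_2[symmetric])
    moreover have "fold (contract 1) [t, - t, 1, x, y] a 1 = (x + y + 1) * a 5 - a 6"
      using a by (simp add: contract_def algebra_simps power2_eq_square numeral_2_eq_2[symmetric])
    ultimately show ?thesis using t(2,3) assms by auto
  qed
  then have "power_sum (length [t, - t, 1, x, y]) a"
    using power_sum_interpolation[OF t(1), of 2 a] by simp
  then show ?thesis by (simp add: eval_nat_numeral)
qed

text \<open>The quartic operator \<open>c\<close> killing the four powers must have \<open>c\<^sub>0 = c\<^sub>3 = c\<^sub>4 = 0\<close>, so two of its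
  roots lie at \<open>(0 : 1)\<close> and one at \<open>(1 : 0)\<close>; as \<open>a\<^sub>4 = 0\<close>, the fourth power contributes nothing to \<open>a\<^sub>5\<close>.\<close>

lemma not_power_sum_4_sparse:
  assumes a: "a 1 = 0" "a 2 = 0" "a 3 = 0" "a 4 = 0" and "a 0 \<noteq> 0" "a 5 \<noteq> 0"
  shows "\<not> power_sum 4 a"
proof
  assume "power_sum 4 a"
  then obtain p q where pq: "\<And>i. i \<le> 6 \<Longrightarrow> a i = (\<Sum>j<4 :: nat. p j ^ (6 - i) * q j ^ i)"
    unfolding power_sum_def by blast
  \<comment> \<open>A zero linear form is replaced by x + y with weight 0, so that all four forms
    define points.\<close>
  define d P Q where "d j = (if (p j, q j) = (0, 0) then 0 else 1 :: complex)"
    and "P j = (if (p j, q j) = (0, 0) then 1 else p j)"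
    and "Q j = (if (p j, q j) = (0, 0) then 1 else q j)" for j
  have nz: "P j \<noteq> 0 \<or> Q j \<noteq> 0" for j by (auto simp: P_def Q_def)
  have "p j ^ (6 - i) * q j ^ i = d j * P j ^ (6 - i) * Q j ^ i" if "i \<le> 6" for i j
    using that by (cases "i = 0") (auto simp: d_def P_def Q_def)
  then have dPQ: "a i = d 0 * P 0 ^ (6 - i) * Q 0 ^ i + d 1 * P 1 ^ (6 - i) * Q 1 ^ i
      + d 2 * P 2 ^ (6 - i) * Q 2 ^ i + d 3 * P 3 ^ (6 - i) * Q 3 ^ i" if "i \<le> 6" for i
    using pq[OF that] that unfolding sum_lt_4 by simp
  \<comment> \<open>Coefficients of the product of the four factors \<open>Q j\<close> -
    \<open>P j\<close> X, each of which kills one of the powers.\<close>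
  define c0 c1 c2 c3 c4 where "c0 = Q 0 * Q 1 * Q 2 * Q 3"
    and "c1 = - (P 0 * Q 1 * Q 2 * Q 3 + Q 0 * P 1 * Q 2 * Q 3 + Q 0 * Q 1 * P 2 * Q 3 + Q 0 * Q 1 * Q 2 * P 3)"
    and "c2 = P 0 * P 1 * Q 2 * Q 3 + P 0 * Q 1 * P 2 * Q 3 + P 0 * Q 1 * Q 2 * P 3
      + Q 0 * P 1 * P 2 * Q 3 + Q 0 * P 1 * Q 2 * P 3 + Q 0 * Q 1 * P 2 * P 3"
    and "c3 = - (P 0 * P 1 * P 2 * Q 3 + P 0 * P 1 * Q 2 * P 3 + P 0 * Q 1 * P 2 * P 3 + Q 0 * P 1 * P 2 * P 3)"
    and "c4 = P 0 * P 1 * P 2 * P 3"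
  note c = c0_def c1_def c2_def c3_def c4_def
  have apolar: "c0 * a i + c1 * a (i + 1) + c2 * a (i + 2) + c3 * a (i + 3) + c4 * a (i + 4) = 0"
    if i: "i \<le> 2" for i
  proof -
    define b where "b j = d j * P j ^ (2 - i) * Q j ^ i" for j
    have summand: "d j * P j ^ (6 - (i + k)) * Q j ^ (i + k) = b j * (P j ^ (4 - k) * Q j ^ k)"
      if "k \<le> 4" for j k
    proof -
      have "6 - (i + k) = (2 - i) + (4 - k)" using i that by simp
      then show ?thesis by (simp add: b_def power_add ac_simps)
    qed
    have expand: "a (i + k) = b 0 * (P 0 ^ (4 - k) * Q 0 ^ k) + b 1 * (P 1 ^ (4 - k) * Q 1 ^ k)
        + b 2 * (P 2 ^ (4 - k) * Q 2 ^ k) + b 3 * (P 3 ^ (4 - k) * Q 3 ^ k)" if "k \<le> 4" for k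
      using dPQ[of "i + k"] that i unfolding summand[OF that] by simp
    show ?thesis
      using expand[of 0] expand[of 1] expand[of 2] expand[of 3] expand[of 4] unfolding c
      by (simp add: algebra_simps power_numeral_reduce)
  qed
  have "c0 = 0" using apolar[of 0] assms by (simp add: numeral_2_eq_2[symmetric])
  moreover have "c4 = 0" using apolar[of 1] assms \<open>c0 = 0\<close> by (simp add: numeral_2_eq_2[symmetric])
  ultimately have "c3 = 0" using apolar[of 2] assms by (simp add: numeral_2_eq_2[symmetric])
  have four: "a 4 = d 0 * P 0 ^ 2 * Q 0 ^ 4 + d 1 * P 1 ^ 2 * Q 1 ^ 4
      + d 2 * P 2 ^ 2 * Q 2 ^ 4 + d 3 * P 3 ^ 2 * Q 3 ^ 4"
    and five: "a 5 = d 0 * P 0 * Q 0 ^ 5 + d 1 * P 1 * Q 1 ^ 5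
      + d 2 * P 2 * Q 2 ^ 5 + d 3 * P 3 * Q 3 ^ 5"
    using dPQ[of 4] dPQ[of 5] by simp_all
  show False
    using \<open>c0 = 0\<close> \<open>c3 = 0\<close> \<open>c4 = 0\<close> nz[of 0] nz[of 1] nz[of 2] nz[of 3] four five
      \<open>a 4 = 0\<close> \<open>a 5 \<noteq> 0\<close>
    unfolding c by auto
qed

lemma sparse_classified:
  assumes a: "a 1 = 0" "a 2 = 0" "a 3 = 0" "a 4 = 0" and stable: "\<not> triple_root a"
  shows "classified a"
proof (cases "a 5 = 0")
  case True
  have "power_sum 2 a"
    by (rule power_sum_2I[of _ "a 0" 1 0 "a 6" 0 1]) (use a True in \<open>auto simp: le_6_cases\<close>)
  then show ?thesis using stable by (rule two_powers_classified)
next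
  case False
  have "a 0 \<noteq> 0"
  proof
    assume "a 0 = 0"
    then have "a i = 0" if "i \<le> 4" for i using a that by (auto simp: le_4_cases)
    then show False
      using triple_rootI[of 0 1 2 a] stable by (simp add: contract_def numeral_2_eq_2)
  qed
  with a False show ?thesis
    using power_sum_5_sparse[of a] not_power_sum_4_sparse[of a]
    by (simp add: classified_def J2_sparse J6_sparse J10_sparse)
qed

text \<open>The form combines x^6, y^6 and (x + r y)^6 with weights \<open>a 0 - a 1 / r\<close>,
  \<open>a 6 - r^5 * a 1\<close> and \<open>a 1 / r\<close>. If a weight vanishes, two powers
  suffice; otherwise \<open>J2 a ^ 3 + J6 a\<close> is nonzero.\<close>

lemma geometric_classified:
  assumes a: "a 2 = r * a 1" "a 3 = r^2 * a 1" "a 4 = r^3 * a 1" "a 5 = r^4 * a 1"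
    and "r \<noteq> 0" and stable: "\<not> triple_root a"
  shows "classified a"
proof (cases "power_sum 2 a")
  case True
  then show ?thesis using stable by (rule two_powers_classified)
next
  case False
  have "power_sum 3 a"
    by (rule power_sum_3I[of _ "a 0 - a 1 / r" 1 0 "a 6 - r^5 * a 1" 0 1 "a 1 / r" 1 r])
      (use a \<open>r \<noteq> 0\<close> in \<open>auto simp: le_6_cases field_simps power_numeral_reduce\<close>)
  moreover have "a 1 \<noteq> 0"
  proof
    assume "a 1 = 0"
    then have "power_sum 2 a"
      by (intro power_sum_2I[of _ "a 0" 1 0 "a 6" 0 1]) (use a in \<open>auto simp: le_6_cases\<close>)
    then show False using False by blast
  qed
  moreover have "r * a 0 \<noteq> a 1"
  proof
    assume "r * a 0 = a 1"
    then have "power_sum 2 a"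
      by (intro power_sum_2I[of _ "a 6 - r^5 * a 1" 0 1 "a 0" 1 r])
        (use a in \<open>auto simp: le_6_cases field_simps power_numeral_reduce\<close>)
    then show False using False by blast
  qed
  moreover have "a 6 \<noteq> r^5 * a 1"
  proof
    assume "a 6 = r^5 * a 1"
    then have "power_sum 2 a"
      by (intro power_sum_2I[of _ "a 0 - a 1 / r" 1 0 "a 1 / r" 1 r])
        (use a \<open>r \<noteq> 0\<close> in \<open>auto simp: le_6_cases field_simps power_numeral_reduce\<close>)
    then show False using False by blast
  qed
  ultimately show ?thesis
    using False \<open>r \<noteq> 0\<close> J2_J6_geometric[OF a] by (simp add: classified_def)
qed

section \<open>From an annihilating cubic operator to the normal forms\<close>

lemma apolar_distinct_classified:
  assumes "u1 * v2 \<noteq> u2 * v1" "(u3, v3) \<noteq> (0, 0)"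
    and "\<And>i. i \<le> 3 \<Longrightarrow> contract u1 v1 (contract u2 v2 (contract u3 v3 a)) i = 0"
    and stable: "\<not> triple_root a"
  shows "classified a"
proof -
  \<comment> \<open>The third point is quantified away, because the normalization tracks only the
    first two.\<close>
  define R where "R a u1 v1 u2 v2 \<longleftrightarrow> (\<exists>u3 v3. (u3, v3) \<noteq> (0, 0) \<and>
      (\<forall>i\<le>3. contract u1 v1 (contract u2 v2 (contract u3 v3 a)) i = 0))" for a u1 v1 u2 v2
  have "R a u1 v1 u2 v2" using assms unfolding R_def by blast
  with assms(1) show ?thesis
  proof (rule normalize_two_points[where R = R])
    fix a u1 v1 u2 v2 t assume "R a u1 v1 u2 v2"
    then obtain u3 v3 where uv: "(u3, v3) \<noteq> (0, 0)"
      "\<And>i. i \<le> 3 \<Longrightarrow> contract u1 v1 (contract u2 v2 (contract u3 v3 a)) i = 0"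
      unfolding R_def by blast
    have "(u3, v3 + t * u3) \<noteq> (0, 0)" using uv(1) by auto
    moreover have "contract u1 (v1 + t * u1) (contract u2 (v2 + t * u2)
        (contract u3 (v3 + t * u3) (shear t a))) i = 0" if "i \<le> 3" for i
      unfolding contract_shear by (rule shear_zero) (use uv(2) that in auto)
    ultimately show "R (shear t a) u1 (v1 + t * u1) u2 (v2 + t * u2)"
      unfolding R_def by blast
  next
    fix a u1 v1 u2 v2 assume "R a u1 v1 u2 v2"
    then obtain u3 v3 where uv: "(u3, v3) \<noteq> (0, 0)"
      "\<And>i. i \<le> 3 \<Longrightarrow> contract u1 v1 (contract u2 v2 (contract u3 v3 a)) i = 0"
      unfolding R_def by blast
    have "(v3, u3) \<noteq> (0, 0)" using uv(1) by auto
    moreover have "contract v1 u1 (contract v2 u2 (contract v3 u3 (flip a))) i = 0" if "i \<le> 3" for i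
      using uv(2)[of "3 - i"] that by (simp add: contract3_flip)
    ultimately show "R (flip a) v1 u1 v2 u2"
      unfolding R_def by blast
  next
    fix a :: "nat \<Rightarrow> complex" and u v
    assume "v \<noteq> 0" "u \<noteq> 0" and stable: "\<not> triple_root a" and "R a 0 v u 0"
    then obtain u3 v3 where uv: "(u3, v3) \<noteq> (0, 0)"
      "\<And>i. i \<le> 3 \<Longrightarrow> v3 * a (Suc i) = u3 * a (Suc (Suc i))"
      unfolding R_def by (auto simp: contract_def)
    have rec: "v3 * a 1 = u3 * a 2" "v3 * a 2 = u3 * a 3" "v3 * a 3 = u3 * a 4" "v3 * a 4 = u3 * a 5"
      using uv(2)[of 0] uv(2)[of 1] uv(2)[of 2] uv(2)[of 3] by (simp_all add: numeral_2_eq_2[symmetric])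
    \<comment> \<open>The relations \<open>rec\<close> make \<open>a 1\<close> to \<open>a 5\<close>
      a recurrence of order one: either all but \<open>a 5\<close> vanish, or all but
      \<open>a 1\<close>, or the entries are geometric with ratio \<open>v3 / u3\<close>.\<close>
    consider "u3 = 0" "v3 \<noteq> 0" | "v3 = 0" "u3 \<noteq> 0" | "u3 \<noteq> 0" "v3 \<noteq> 0" using uv(1) by auto
    then show "classified a"
    proof cases
      case 1
      then show ?thesis using sparse_classified[of a] rec stable by simp
    next
      case 2
      then have "classified (flip a)"
        using sparse_classified[of "flip a"] rec stable by (simp add: flip_def triple_root_flip)
      then show ?thesis by (simp add: classified_flip)
    next
      case 3
      define r where "r = v3 / u3"
      have "r * a 1 = a 2" "r * a 2 = a 3" "r * a 3 = a 4" "r * a 4 = a 5"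
        using rec 3 by (simp_all add: r_def field_simps)
      then show ?thesis
        using geometric_classified[of a r] 3 stable
        by (auto simp: r_def[symmetric] power_numeral_reduce ac_simps)
          (simp add: r_def)
    qed
  qed (rule stable)
qed

lemma proportional_points:
  fixes u v u' v' :: complex
  assumes "u * v' = u' * v" "(u, v) \<noteq> (0, 0)" "(u', v') \<noteq> (0, 0)"
  obtains k where "k \<noteq> 0" "u' = k * u" "v' = k * v"
proof (cases "u = 0")
  case True
  then show ?thesis using that[of "v' / v"] assms by auto
next
  case False
  then have "v' = (u' / u) * v" using assms(1) by (simp add: field_simps)
  then show ?thesis using that[of "u' / u"] False assms by (cases "u' = 0") (auto simp: field_simps)
qed

text \<open>The operator splits into first-order factors, which commute. If the first is independent
  of another one, that pair can be normalized; otherwise all are proportional and a single factor,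
  applied three times, kills the form, giving a triple root.\<close>

lemma apolar_classified:
  assumes c: "(c0, c1, c2, c3) \<noteq> (0, 0, 0, 0)"
    and apolar: "\<And>i. i \<le> 3 \<Longrightarrow> c0 * a i + c1 * a (i + 1) + c2 * a (i + 2) + c3 * a (i + 3) = 0"
    and stable: "\<not> triple_root a"
  shows "classified a"
proof -
  obtain u1 v1 u2 v2 u3 v3 where split: "c0 = v1 * v2 * v3"
    "c1 = - (u1 * v2 * v3 + v1 * u2 * v3 + v1 * v2 * u3)"
    "c2 = u1 * u2 * v3 + u1 * v2 * u3 + v1 * u2 * u3" "c3 = - (u1 * u2 * u3)"
    by (rule cubic_splits)
  have nz: "(u1, v1) \<noteq> (0, 0)" "(u2, v2) \<noteq> (0, 0)" "(u3, v3) \<noteq> (0, 0)"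
    using c unfolding split by auto
  have zero: "contract u1 v1 (contract u2 v2 (contract u3 v3 a)) i = 0" if "i \<le> 3" for i
    using apolar[OF that] unfolding split
    by (simp add: contract_def algebra_simps numeral_2_eq_2 numeral_3_eq_3)
  show ?thesis
  proof (cases "u1 * v2 = u2 * v1")
    case False
    then show ?thesis using apolar_distinct_classified[OF _ nz(3) zero stable] by blast
  next
    case 12: True
    show ?thesis
    proof (cases "u1 * v3 = u3 * v1")
      case False
      then show ?thesis
        using apolar_distinct_classified[of u1 v3 u3 v1 u2 v2 a] nz(2) zero stable
        by (simp add: contract_commute[of u3 v3])
    next
      case 13: True
      obtain k where k: "k \<noteq> 0" "u2 = k * u1" "v2 = k * v1"
        using proportional_points[OF 12 nz(1,2)] .
      obtain l where l: "l \<noteq> 0" "u3 = l * u1" "v3 = l * v1"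
        using proportional_points[OF 13 nz(1,3)] .
      have "(contract u1 v1 ^^ 3) a i = 0" if "i \<le> 3" for i
        using zero[OF that] k(1) l(1) unfolding k l
        by (simp add: contract_scale contract_scale_arg numeral_3_eq_3)
      then show ?thesis using triple_rootI[OF nz(1), of 3 a] stable by simp
    qed
  qed
qed

subsection \<open>Binary forms as coefficient sequences\<close>

lemma I2_eq: "I2 f = J2 (sextic_coeff f)"
  by (simp add: I2_def J2_def Let_def)

lemma I6_eq: "I6 f = J6 (sextic_coeff f)"
proof -
  have "det (mat_of_rows_list 3 [[b0, b1, b2], [b1, b2, b3], [b2, b3, b4]])
      = b0 * (b2 * b4 - b3^2) - b1 * (b1 * b4 - b2 * b3) + b2 * (b1 * b3 - b2^2)"
    for b0 b1 b2 b3 b4 :: complex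
  proof -
    have "mat_of_rows_list 3 [[b0, b1, b2], [b1, b2, b3], [b2, b3, b4]] \<in> carrier_mat 3 3"
      by (simp add: mat_of_rows_list_def numeral_3_eq_3)
    from det3[OF this] show ?thesis by (simp add: mat_of_rows_list_def power2_eq_square)
  qed
  then show ?thesis
    unfolding I6_def J6_def hankel3_def quartic_values Let_def .
qed

section \<open>The discriminant as a Bezout determinant\<close>

lemma coeff_poly_1:
  assumes "binary_form d g" "k \<le> d"
  shows "coeff (poly g 1) k = coeff (coeff g (d - k)) k"
proof -
  have "coeff (poly g 1) k = (\<Sum>j\<le>degree g. coeff (coeff g j) k)"
    by (simp add: poly_altdef coeff_sum)
  \<comment> \<open>By homogeneity only one power of y accompanies x^k, so setting y = 1 merges no
    terms.\<close>
  also have "\<dots> = (\<Sum>j\<in>{d - k}. coeff (coeff g j) k)"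
  proof (rule sum.mono_neutral_cong)
    fix j assume "j \<in> {..degree g} - {d - k}"
    then show "coeff (coeff g j) k = 0"
      using assms unfolding binary_form_def by fastforce
  next
    fix j assume "j \<in> {d - k} - {..degree g}"
    then show "coeff (coeff g j) k = 0" by (simp add: coeff_eq_0)
  qed auto
  finally show ?thesis by simp
qed

lemma coeff_sextic:
  assumes "i \<le> 6"
  shows "coeff (coeff f i) (6 - i) = of_nat (6 choose i) * sextic_coeff f i"
  using assms by (simp add: sextic_coeff_def)

lemma le_5_cases: "i \<le> 5 \<longleftrightarrow> i = 0 \<or> i = 1 \<or> i = 2 \<or> i = 3 \<or> i = 4 \<or> i = (5::nat)"
  by auto

lemma choose_6_values:
  "6 choose 1 = 6" "6 choose 2 = 15" "6 choose 3 = 20" "6 choose 4 = 15" "6 choose 5 = (6::nat)"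
  by (simp_all add: eval_nat_numeral)

lemma coeff_partial_x:
  assumes f: "binary_form 6 f" and "m \<le> 5"
  shows "coeff (poly (partial_x f) 1) (5 - m) = 6 * of_nat (5 choose m) * sextic_coeff f m"
proof -
  have "binary_form 5 (partial_x f)"
    unfolding binary_form_def
  proof (intro allI impI)
    fix i j assume "coeff (coeff (partial_x f) j) i \<noteq> 0"
    then have "coeff (coeff f j) (Suc i) \<noteq> 0"
      by (simp add: partial_x_def coeff_map_poly coeff_pderiv)
    then have "Suc i + j = 6" using f unfolding binary_form_def by blast
    then show "i + j = 5" by simp
  qed
  then have "coeff (poly (partial_x f) 1) (5 - m) = of_nat (6 - m) * coeff (coeff f m) (6 - m)"
  proof -
    have "Suc (5 - m) = 6 - m" using assms(2) by simp
    then show ?thesis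
      using coeff_poly_1[OF \<open>binary_form 5 (partial_x f)\<close>, of "5 - m"] assms(2)
      by (simp add: partial_x_def coeff_map_poly coeff_pderiv del: of_nat_Suc)
  qed
  moreover have "of_nat (6 - m) * of_nat (6 choose m) = (6 * of_nat (5 choose m) :: complex)"
  proof -
    have "(6 - m) * (6 choose m) = 6 * (5 choose m)"
      using assms(2) unfolding le_5_cases
      by (elim disjE) (simp_all add: choose_values choose_6_values)
    then show ?thesis by (metis of_nat_mult of_nat_numeral)
  qed
  ultimately show ?thesis
    using assms(2) coeff_sextic[of m f] by (simp add: mult.assoc[symmetric])
qed

lemma coeff_partial_y:
  assumes f: "binary_form 6 f" and "m \<le> 5"
  shows "coeff (poly (partial_y f) 1) (5 - m) = 6 * of_nat (5 choose m) * sextic_coeff f (m + 1)"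
proof -
  have coeff: "coeff (coeff (partial_y f) j) i = of_nat (Suc j) * coeff (coeff f (Suc j)) i" for i j
  proof -
    have "coeff (of_nat n * p) i = of_nat n * coeff p i" for n and p :: "complex poly"
      by (simp add: of_nat_poly)
    then show ?thesis by (simp add: partial_y_def coeff_pderiv del: of_nat_Suc)
  qed
  have "binary_form 5 (partial_y f)"
    unfolding binary_form_def
  proof (intro allI impI)
    fix i j assume "coeff (coeff (partial_y f) j) i \<noteq> 0"
    then have "coeff (coeff f (Suc j)) i \<noteq> 0" unfolding coeff by auto
    then have "i + Suc j = 6" using f unfolding binary_form_def by blast
    then show "i + j = 5" by simp
  qed
  then have "coeff (poly (partial_y f) 1) (5 - m)
      = of_nat (m + 1) * coeff (coeff f (m + 1)) (6 - (m + 1))"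
    using assms(2) by (simp add: coeff_poly_1 coeff del: of_nat_Suc)
  moreover have "of_nat (m + 1) * of_nat (6 choose (m + 1)) = (6 * of_nat (5 choose m) :: complex)"
  proof -
    have "(m + 1) * (6 choose (m + 1)) = 6 * (5 choose m)"
      using assms(2) unfolding le_5_cases
      by (elim disjE) (simp_all add: choose_values choose_6_values numeral_2_eq_2[symmetric])
    then show ?thesis by (metis of_nat_mult of_nat_numeral)
  qed
  ultimately show ?thesis
    using assms(2) coeff_sextic[of "m + 1" f] by (simp add: mult.assoc[symmetric])
qed

text \<open>The transposed Sylvester matrix consists of four Toeplitz blocks. The lower two commute,
  so its determinant is that of \<open>A * D - B * C\<close>, which is 36 times the Bezout
  matrix.\<close>

lemma I10_eq:
  assumes f: "binary_form 6 f"
  shows "I10 f = J10 (sextic_coeff f)"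
proof -
  define a where "a = sextic_coeff f"
  define F G where "F m = 6 * of_nat (5 choose m) * a m"
    and "G m = 6 * of_nat (5 choose m) * a (m + 1)" for m
  define S where "S = sylvester_mat_sub 5 5 (poly (partial_x f) 1) (poly (partial_y f) 1)"
  \<comment> \<open>\<open>C\<close> and \<open>D\<close> are upper triangular: below the diagonal
    the index exceeds 5, where \<open>F\<close> and \<open>G\<close> vanish.\<close>
  define A B C D where "A = mat 5 5 (\<lambda>(i, j). if j \<le> i then F (i - j) else 0)"
    and "B = mat 5 5 (\<lambda>(i, j). if j \<le> i then G (i - j) else 0)"
    and "C = mat 5 5 (\<lambda>(i, j). F (5 + i - j))"
    and "D = mat 5 5 (\<lambda>(i, j). G (5 + i - j))"
  have carrier: "A \<in> carrier_mat 5 5" "B \<in> carrier_mat 5 5" "C \<in> carrier_mat 5 5" "D \<in> carrier_mat 5 5"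
    by (simp_all add: A_def B_def C_def D_def)
  have big: "F m = 0" "G m = 0" if "m > 5" for m
    using that by (simp_all add: F_def G_def)
  have S: "S \<in> carrier_mat 10 10" by (simp add: S_def carrier_matI)
  have entry: "S $$ (i, j) = (if i < 5 then if i \<le> j then F (j - i) else 0
      else if i - 5 \<le> j then G (j - (i - 5)) else 0)" if ij: "i < 10" "j < 10" for i j
  proof -
    have "coeff (poly (partial_x f) 1) (5 + i - j) = F (j - i)" if "i \<le> j" "j - i \<le> 5"
      using coeff_partial_x[OF f, of "j - i"] that by (simp add: F_def a_def)
    moreover have "coeff (poly (partial_y f) 1) (i - j) = G (j - (i - 5))"
      if "\<not> i < 5" "i - 5 \<le> j" "j \<le> i"
    proof -
      have "i - j = 5 - (j - (i - 5))" "j - (i - 5) \<le> 5" using that by auto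
      then show ?thesis using coeff_partial_y[OF f, of "j - (i - 5)"] by (simp add: G_def a_def)
    qed
    moreover have "S $$ (i, j) = (if i < 5 then
       if i \<le> j \<and> j - i \<le> 5 then coeff (poly (partial_x f) 1) (5 + i - j) else 0
       else if i - 5 \<le> j \<and> j \<le> i then coeff (poly (partial_y f) 1) (i - j) else 0)"
      unfolding S_def by (rule sylvester_mat_sub_index) (use ij in auto)
    ultimately show ?thesis using big[of "j - i"] big[of "j - (i - 5)"] by auto
  qed
  have "transpose_mat S = four_block_mat A B C D"
  proof (rule eq_matI)
    fix i j assume "i < dim_row (four_block_mat A B C D)" "j < dim_col (four_block_mat A B C D)"
    then have ij: "i < 10" "j < 10" using carrier by auto
    then have "transpose_mat S $$ (i, j) = S $$ (j, i)" using S by simp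
    then show "transpose_mat S $$ (i, j) = four_block_mat A B C D $$ (i, j)"
      using ij carrier big by (auto simp: entry A_def B_def C_def D_def not_less not_le)
  qed (use S carrier in auto)
  \<comment> \<open>Upper triangular Toeplitz matrices are polynomials in one nilpotent
    shift.\<close>
  moreover have "C * D = D * C"
  proof (rule eq_matI)
    fix i j assume "i < dim_row (D * C)" "j < dim_col (D * C)"
    then have ij: "i < 5" "j < 5" using carrier by auto
    have "(\<Sum>k = 0..<5. F (5 + i - k) * G (5 + k - j)) = (\<Sum>k = 0..<5. G (5 + i - k) * F (5 + k - j))"
      using ij unfolding less_5_cases sum_lt_5
      by (elim disjE) (simp_all add: big algebra_simps)
    then show "(C * D) $$ (i, j) = (D * C) $$ (i, j)"
      using ij carrier by (simp add: C_def D_def scalar_prod_def)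
  qed (use carrier in auto)
  ultimately have "det S = det (A * D - B * C)"
    using det_transpose[OF S] det_four_block_mat[OF carrier] by simp
  also have "A * D - B * C = 36 \<cdot>\<^sub>m mat 5 5 (\<lambda>(i, j). bezout a i j)"
  proof (rule eq_matI)
    fix i j
    assume "i < dim_row (36 \<cdot>\<^sub>m mat 5 5 (\<lambda>(i, j). bezout a i j))"
      "j < dim_col (36 \<cdot>\<^sub>m mat 5 5 (\<lambda>(i, j). bezout a i j))"
    then have ij: "i < 5" "j < 5" by auto
    have restrict: "(\<Sum>k = 0..<5. (if k \<le> i then g (i - k) else 0) * h k) = (\<Sum>k\<le>i. g (i - k) * h k)"
      for g h :: "nat \<Rightarrow> complex"
      by (rule sum.mono_neutral_cong_right) (use ij in auto)
    have "(A * D - B * C) $$ (i, j)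
        = (\<Sum>k\<le>i. F (i - k) * G (5 + k - j)) - (\<Sum>k\<le>i. G (i - k) * F (5 + k - j))"
      using ij carrier
      by (simp add: A_def B_def C_def D_def scalar_prod_def
          restrict[of F "\<lambda>k. G (5 + k - j)"] restrict[of G "\<lambda>k. F (5 + k - j)"])
    also have "\<dots> = 36 * bezout a i j"
      unfolding bezout_def sum_distrib_left sum_subtractf[symmetric]
      by (rule sum.cong) (simp_all add: F_def G_def algebra_simps)
    finally show "(A * D - B * C) $$ (i, j) = (36 \<cdot>\<^sub>m mat 5 5 (\<lambda>(i, j). bezout a i j)) $$ (i, j)"
      using ij by simp
  qed (use carrier in auto)
  \<comment> \<open>The factor 36^5 = 6^10 is exactly the normalization in
    \<open>I10\<close>.\<close>
  also have "det \<dots> = 36 ^ 5 * J10 a"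
    by (simp add: J10_def det_smult)
  finally show ?thesis
    unfolding I10_def sextic_discriminant_def form_resultant_def S_def[symmetric] a_def[symmetric]
    by simp
qed

text \<open>\<open>I4\<close> is the determinant of the catalecticant matrix, whose kernel vectors
  are the coefficients of the cubic operators annihilating the form.\<close>

lemma I4_kernel:
  assumes "I4 f = 0"
  obtains c0 c1 c2 c3 where "(c0, c1, c2, c3) \<noteq> (0, 0, 0, 0)"
    "\<And>i. i \<le> 3 \<Longrightarrow> c0 * sextic_coeff f i + c1 * sextic_coeff f (i + 1)
       + c2 * sextic_coeff f (i + 2) + c3 * sextic_coeff f (i + 3) = 0"
proof -
  define a where "a = sextic_coeff f"
  define A where "A = mat_of_rows_list 4 [[a 0, a 1, a 2, a 3], [a 1, a 2, a 3, a 4],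
    [a 2, a 3, a 4, a 5], [a 3, a 4, a 5, a 6]]"
  have A: "A \<in> carrier_mat 4 4" by (simp add: A_def mat_of_rows_list_def eval_nat_numeral)
  have "det A = 0" using assms by (simp add: I4_def A_def a_def Let_def)
  then obtain v where v: "v \<in> carrier_vec 4" "v \<noteq> 0\<^sub>v 4" "A *\<^sub>v v = 0\<^sub>v 4"
    using det_0_iff_vec_prod_zero[OF A] by blast
  have sum4: "(\<Sum>j = 0..<4 :: nat. g j) = g 0 + g 1 + g 2 + g 3" for g :: "nat \<Rightarrow> complex"
    by (simp add: eval_nat_numeral)
  have "(v $ 0, v $ 1, v $ 2, v $ 3) \<noteq> (0, 0, 0, 0)"
  proof
    assume zero: "(v $ 0, v $ 1, v $ 2, v $ 3) = (0, 0, 0, 0)"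
    have "v = 0\<^sub>v 4"
    proof (rule eq_vecI)
      fix i assume "i < dim_vec (0\<^sub>v 4 :: complex vec)"
      then have "i \<le> 3" by simp
      then show "v $ i = 0\<^sub>v 4 $ i" using zero unfolding le_3_cases by auto
    qed (use v in simp)
    with v(2) show False by blast
  qed
  moreover have "v $ 0 * a i + v $ 1 * a (i + 1) + v $ 2 * a (i + 2) + v $ 3 * a (i + 3) = 0"
    if "i \<le> 3" for i
  proof -
    have "row A i \<bullet> v = 0"
      using arg_cong[OF v(3), of "\<lambda>w. w $ i"] that A by simp
    then have "(\<Sum>j = 0..<4. A $$ (i, j) * v $ j) = 0"
      using v(1) A that by (simp add: scalar_prod_def)
    then show ?thesis
      using that unfolding sum4 le_3_cases
      by (elim disjE) (simp_all add: A_def mat_of_rows_list_def numeral_2_eq_2[symmetric] numeral_3_eq_3[symmetric]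
          algebra_simps)
  qed
  ultimately show ?thesis using that unfolding a_def by blast
qed

section \<open>Waring rank in terms of coefficient sequences\<close>

lemma monomial_eq: "cst c * var_x ^ k * var_y ^ n = monom (monom c k) n"
proof -
  have "var_x ^ k = [:monom 1 k:]"
    by (induction k) (auto simp: var_x_def monom_Suc one_pCons monom_0)
  moreover have "var_y ^ n = monom 1 n"
    by (induction n) (auto simp: var_y_def monom_Suc one_pCons monom_0)
  ultimately show ?thesis by (simp add: cst_def smult_monom)
qed

lemma cst_add: "cst (a + b) = cst a + cst b"
  and cst_mult: "cst (a * b) = cst a * cst b"
  and cst_diff: "cst (a - b) = cst a - cst b"
  and cst_uminus: "cst (- a) = - cst a"
  and cst_0: "cst 0 = 0"
  and cst_1: "cst 1 = 1"
  by (simp_all add: cst_def one_pCons)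

lemma cst_power: "cst (a ^ n) = cst a ^ n"
  by (induction n) (simp_all add: cst_1 cst_mult)

lemma cst_of_nat: "cst (of_nat n) = of_nat n"
  by (induction n) (simp_all add: cst_0 cst_1 cst_add)

lemma cst_sum: "cst (\<Sum>j\<in>A. g j) = (\<Sum>j\<in>A. cst (g j))"
  by (induction A rule: infinite_finite_induct) (simp_all add: cst_0 cst_add)

lemma sextic_coeff_expansion:
  assumes "k \<le> 6"
  shows "sextic_coeff (\<Sum>i\<le>6. cst (of_nat (6 choose i) * b i) * var_x ^ (6 - i) * var_y ^ i) k = b k"
proof -
  have "coeff (\<Sum>i\<le>6. monom (monom (of_nat (6 choose i) * b i) (6 - i)) i) k
      = monom (of_nat (6 choose k) * b k) (6 - k)"
    using assms by (simp add: coeff_sum if_distrib cong: if_cong)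
  then show ?thesis
    using assms by (simp add: sextic_coeff_def monomial_eq)
qed

lemma linear_form_power_6:
  "(cst p * var_x + cst q * var_y) ^ 6
    = (\<Sum>i\<le>6. cst (of_nat (6 choose i) * (p ^ (6 - i) * q ^ i)) * var_x ^ (6 - i) * var_y ^ i)"
proof -
  \<comment> \<open>Swapping the summands lets the binomial index count the power of y.\<close>
  have "(cst p * var_x + cst q * var_y) ^ 6 = (cst q * var_y + cst p * var_x) ^ 6"
    by (simp add: add.commute)
  also have "\<dots> = (\<Sum>i\<le>6. of_nat (6 choose i) * (cst q * var_y) ^ i * (cst p * var_x) ^ (6 - i))"
    by (rule binomial_ring)
  also have "\<dots> = (\<Sum>i\<le>6. cst (of_nat (6 choose i) * (p ^ (6 - i) * q ^ i)) * var_x ^ (6 - i) * var_y ^ i)"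
    by (rule sum.cong) (simp_all add: cst_mult cst_of_nat cst_power power_mult_distrib ac_simps)
  finally show ?thesis .
qed

lemma binary_form_1_iff: "binary_form 1 l \<longleftrightarrow> (\<exists>p q. l = cst p * var_x + cst q * var_y)"
proof
  assume l: "binary_form 1 l"
  have "l = cst (coeff (coeff l 0) 1) * var_x + cst (coeff (coeff l 1) 0) * var_y"
  proof (intro poly_eqI)
    fix i j
    have "cst c * var_x = monom (monom c 1) 0" "cst c * var_y = monom (monom c 0) 1" for c
      using monomial_eq[of c 1 0] monomial_eq[of c 0 1] by simp_all
    moreover have "coeff (coeff l j) i = 0" if "i + j \<noteq> 1"
      using l that unfolding binary_form_def by blast
    ultimately show "coeff (coeff l j) i
      = coeff (coeff (cst (coeff (coeff l 0) 1) * var_x + cst (coeff (coeff l 1) 0) * var_y) j) i"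
      by (cases "i + j = 1") (auto simp: add_is_1)
  qed
  then show "\<exists>p q. l = cst p * var_x + cst q * var_y" by blast
next
  assume "\<exists>p q. l = cst p * var_x + cst q * var_y"
  then obtain p q where "l = monom (monom p 1) 0 + monom (monom q 0) 1"
    using monomial_eq[of _ 1 0] monomial_eq[of _ 0 1] by auto
  then show "binary_form 1 l" unfolding binary_form_def by auto
qed

lemma sum_sixth_powers:
  "(\<Sum>j<r. (cst (p j) * var_x + cst (q j) * var_y) ^ 6)
    = (\<Sum>i\<le>6. cst (of_nat (6 choose i) * (\<Sum>j<r. p j ^ (6 - i) * q j ^ i)) * var_x ^ (6 - i) * var_y ^ i)"
proof -
  have "(\<Sum>j<r. (cst (p j) * var_x + cst (q j) * var_y) ^ 6)
      = (\<Sum>i\<le>6. \<Sum>j<r. cst (of_nat (6 choose i) * (p j ^ (6 - i) * q j ^ i)) * var_x ^ (6 - i) * var_y ^ i)"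
    unfolding linear_form_power_6 by (rule sum.swap)
  then show ?thesis by (simp add: sum_distrib_left sum_distrib_right cst_sum)
qed

lemma power_sum_iff:
  assumes f: "binary_form 6 f"
  shows "(\<exists>l :: nat \<Rightarrow> complex poly poly. (\<forall>j<r. binary_form 1 (l j)) \<and> f = (\<Sum>j<r. l j ^ 6))
    \<longleftrightarrow> power_sum r (sextic_coeff f)"
proof
  assume "\<exists>l. (\<forall>j<r. binary_form 1 (l j)) \<and> f = (\<Sum>j<r. l j ^ 6)"
  then obtain l where l: "\<forall>j<r. binary_form 1 (l j)" "f = (\<Sum>j<r. l j ^ 6)" by blast
  then have "\<forall>j. \<exists>p q. j < r \<longrightarrow> l j = cst p * var_x + cst q * var_y"
    unfolding binary_form_1_iff by blast
  then obtain p q where pq: "\<And>j. j < r \<Longrightarrow> l j = cst (p j) * var_x + cst (q j) * var_y"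
    by metis
  have "f = (\<Sum>j<r. (cst (p j) * var_x + cst (q j) * var_y) ^ 6)"
    unfolding l(2) by (rule sum.cong) (simp_all add: pq)
  then have "sextic_coeff f i = (\<Sum>j<r. p j ^ (6 - i) * q j ^ i)" if "i \<le> 6" for i
    unfolding sum_sixth_powers using that by (simp add: sextic_coeff_expansion)
  then show "power_sum r (sextic_coeff f)" unfolding power_sum_def by blast
next
  assume "power_sum r (sextic_coeff f)"
  then obtain p q where pq: "\<And>i. i \<le> 6 \<Longrightarrow> sextic_coeff f i = (\<Sum>j<r. p j ^ (6 - i) * q j ^ i)"
    unfolding power_sum_def by blast
  have "f = (\<Sum>i\<le>6. cst (of_nat (6 choose i) * (\<Sum>j<r. p j ^ (6 - i) * q j ^ i)) * var_x ^ (6 - i) * var_y ^ i)"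
    by (subst binary_form_6_expansion[OF f], rule sum.cong) (simp_all add: pq)
  then have "f = (\<Sum>j<r. (cst (p j) * var_x + cst (q j) * var_y) ^ 6)"
    unfolding sum_sixth_powers .
  then show "\<exists>l. (\<forall>j<r. binary_form 1 (l j)) \<and> f = (\<Sum>j<r. l j ^ 6)"
    by (intro exI[of _ "\<lambda>j. cst (p j) * var_x + cst (q j) * var_y"]) (auto simp: binary_form_1_iff[unfolded One_nat_def])
qed

text \<open>By padding, a failure at length \<open>r\<close> excludes all shorter lengths as
  well.\<close>

lemma waring_rank_eq:
  assumes "binary_form 6 f" "power_sum (Suc r) (sextic_coeff f)" "\<not> power_sum r (sextic_coeff f)"
  shows "waring_rank 6 f = Suc r"
  unfolding waring_rank_def power_sum_iff[OF assms(1)]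
proof (rule Least_equality)
  show "power_sum (Suc r) (sextic_coeff f)" by (rule assms(2))
next
  fix s assume "power_sum s (sextic_coeff f)"
  then show "Suc r \<le> s" using power_sum_mono[of s "sextic_coeff f" r] assms(3) by force
qed

section \<open>Stable sextics have no triple root\<close>

lemma contract_4: "(contract u v ^^ 4) a k
  = v^4 * a k - 4 * v^3 * u * a (k + 1) + 6 * v^2 * u^2 * a (k + 2) - 4 * v * u^3 * a (k + 3) + u^4 * a (k + 4)"
proof -
  have "(contract u v ^^ 4) a k = contract u v (contract u v (contract u v (contract u v a))) k"
    by (simp add: eval_nat_numeral)
  also have "\<dots> = v^4 * a k - 4 * v^3 * u * a (Suc k) + 6 * v^2 * u^2 * a (Suc (Suc k))
      - 4 * v * u^3 * a (Suc (Suc (Suc k))) + u^4 * a (Suc (Suc (Suc (Suc k))))"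
    unfolding contract_def by (simp add: algebra_simps power_numeral_reduce)
  finally have eq: "(contract u v ^^ 4) a k = \<dots>" .
  have "k + 1 = Suc k" "k + 2 = Suc (Suc k)" "k + 3 = Suc (Suc (Suc k))"
    "k + 4 = Suc (Suc (Suc (Suc k)))"
    by simp_all
  then show ?thesis by (simp only: eq)
qed

text \<open>The three vanishing values allow the cube of a linear form to be split off explicitly,
  against the bound on multiplicities.\<close>

lemma stable_no_triple_root:
  assumes f: "binary_form 6 f" and "stable_sextic f"
  shows "\<not> triple_root (sextic_coeff f)"
proof
  define a where "a = sextic_coeff f"
  assume "triple_root (sextic_coeff f)"
  then obtain u v where uv: "(u, v) \<noteq> (0, 0)" and zero: "\<And>k. k \<le> 2 \<Longrightarrow> (contract u v ^^ 4) a k = 0"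
    unfolding triple_root_def a_def by blast
  \<comment> \<open>The linear form vanishing at (v : -u), the point at which the four contractions
    evaluate the second partial derivatives.\<close>
  define l where "l = cst (- u) * var_x - cst v * var_y"
  have cst_numeral: "cst (numeral n) = numeral n" for n
    using cst_of_nat[of "numeral n"] by simp
  have expansion: "f = cst (a 0) * var_x ^ 6 + cst (6 * a 1) * var_x ^ 5 * var_y
      + cst (15 * a 2) * var_x ^ 4 * var_y ^ 2 + cst (20 * a 3) * var_x ^ 3 * var_y ^ 3
      + cst (15 * a 4) * var_x ^ 2 * var_y ^ 4 + cst (6 * a 5) * var_x * var_y ^ 5
      + cst (a 6) * var_y ^ 6"
  proof -
    have "{..6 :: nat} = {0, 1, 2, 3, 4, 5, 6}" by auto
    then show ?thesis
      by (subst binary_form_6_expansion[OF f]) (simp add: a_def choose_6_values add.assoc)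
  qed
  \<comment> \<open>\<open>l\<close> differs from y, or from x - s y, only by a nonzero
    constant.\<close>
  have scale: "(cst k * m) ^ 3 dvd f" if "k \<noteq> 0" "m ^ 3 dvd f" for k m
  proof -
    have "(cst k * m) ^ 3 * cst ((1 / k) ^ 3) = cst (k ^ 3 * (1 / k) ^ 3) * m ^ 3"
      unfolding cst_mult cst_power power_mult_distrib by (simp only: ac_simps)
    also have "k ^ 3 * (1 / k) ^ 3 = 1"
      using \<open>k \<noteq> 0\<close> by (simp flip: power_mult_distrib)
    finally have "m ^ 3 = (cst k * m) ^ 3 * cst ((1 / k) ^ 3)" by (simp add: cst_1)
    then have "(cst k * m) ^ 3 dvd m ^ 3" by (rule dvdI)
    then show ?thesis using that(2) by (rule dvd_trans)
  qed
  have "l ^ 3 dvd f"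
  proof (cases "u = 0")
    case True
    then have "v \<noteq> 0" using uv by simp
    then have "a 0 = 0" "a 1 = 0" "a 2 = 0"
      using zero[of 0] zero[of 1] zero[of 2] True unfolding contract_4 by auto
    then have "f = var_y ^ 3 * (cst (20 * a 3) * var_x ^ 3 + cst (15 * a 4) * var_x ^ 2 * var_y
        + cst (6 * a 5) * var_x * var_y ^ 2 + cst (a 6) * var_y ^ 3)"
      unfolding expansion by (simp add: cst_0 algebra_simps power_numeral_reduce)
    then have "var_y ^ 3 dvd f" by (rule dvdI)
    moreover have "l = cst (- v) * var_y" by (simp add: l_def True cst_0 cst_uminus)
    ultimately show ?thesis using scale[of "- v" var_y] \<open>v \<noteq> 0\<close> by simp
  next
    case False
    define s where "s = - (v / u)"
    have "s^4 * a k + 4 * s^3 * a (k + 1) + 6 * s^2 * a (k + 2) + 4 * s * a (k + 3) + a (k + 4) = 0"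
      if "k \<le> 2" for k
    proof -
      have v: "v = - (s * u)" using False by (simp add: s_def)
      have "(contract u v ^^ 4) a k = u^4 * (s^4 * a k + 4 * s^3 * a (k + 1) + 6 * s^2 * a (k + 2)
          + 4 * s * a (k + 3) + a (k + 4))"
        unfolding contract_4 v by (simp add: algebra_simps power_numeral_reduce)
      then show ?thesis using zero[OF that] False by simp
    qed
    from this[of 0] this[of 1] this[of 2]
    have "s^4 * a 0 + 4 * s^3 * a 1 + 6 * s^2 * a 2 + 4 * s * a 3 + a 4 = 0"
      "s^4 * a 1 + 4 * s^3 * a 2 + 6 * s^2 * a 3 + 4 * s * a 4 + a 5 = 0"
      "s^4 * a 2 + 4 * s^3 * a 3 + 6 * s^2 * a 4 + 4 * s * a 5 + a 6 = 0"
      by (simp_all add: numeral_2_eq_2[symmetric])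
    then have a4: "a 4 = - (s^4 * a 0 + 4 * s^3 * a 1 + 6 * s^2 * a 2 + 4 * s * a 3)"
      and a5: "a 5 = - (s^4 * a 1 + 4 * s^3 * a 2 + 6 * s^2 * a 3 + 4 * s * a 4)"
      and a6: "a 6 = - (s^4 * a 2 + 4 * s^3 * a 3 + 6 * s^2 * a 4 + 4 * s * a 5)"
      by (simp_all only: eq_neg_iff_add_eq_0 add.commute[of "a 4"] add.commute[of "a 5"] add.commute[of "a 6"])
    \<comment> \<open>Coefficients of the quotient of f by (x - s y)^3, obtained by long division
      from the top four coefficients; the relations for \<open>a 4\<close>, \<open>a 5\<close> and
      \<open>a 6\<close> say that nothing remains.\<close>
    define h0 h1 h2 h3 where "h0 = a 0" and "h1 = 6 * a 1 + 3 * s * h0"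
      and "h2 = 15 * a 2 + 3 * s * h1 - 3 * s^2 * h0"
      and "h3 = 20 * a 3 + 3 * s * h2 - 3 * s^2 * h1 + s^3 * h0"
    have coeffs: "a 0 = h0" "6 * a 1 = h1 - 3 * s * h0" "15 * a 2 = h2 - 3 * s * h1 + 3 * s^2 * h0"
      "20 * a 3 = h3 - 3 * s * h2 + 3 * s^2 * h1 - s^3 * h0"
      "15 * a 4 = - (3 * s * h3) + 3 * s^2 * h2 - s^3 * h1"
      "6 * a 5 = 3 * s^2 * h3 - s^3 * h2" "a 6 = - (s^3 * h3)"
      unfolding a6 a5 a4 h3_def h2_def h1_def h0_def
      by (simp_all add: algebra_simps power_numeral_reduce)
    have "f = (var_x - cst s * var_y) ^ 3 * (cst h0 * var_x ^ 3 + cst h1 * var_x ^ 2 * var_y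
        + cst h2 * var_x * var_y ^ 2 + cst h3 * var_y ^ 3)"
      unfolding expansion coeffs cst_add cst_diff cst_uminus cst_mult cst_power cst_numeral
      by (simp add: algebra_simps power_numeral_reduce)
    then have "(var_x - cst s * var_y) ^ 3 dvd f" by (rule dvdI)
    moreover have "l = cst (- u) * (var_x - cst s * var_y)"
      using False by (simp add: l_def s_def right_diff_distrib mult.assoc[symmetric] cst_mult[symmetric])
    ultimately show ?thesis using scale[of "- u" "var_x - cst s * var_y"] False by simp
  qed
  have "\<not> is_unit l"
  proof
    assume "is_unit l"
    moreover have "l = [:[:0, - u:], [:- v:]:]"
      by (simp add: l_def cst_def var_x_def var_y_def)
    ultimately show False using uv by (auto simp: is_unit_poly_iff is_unit_pCons_iff)
  qed
  then have "3 \<le> multiplicity l f"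
    using multiplicity_geI[OF _ _ \<open>l ^ 3 dvd f\<close>] assms(2) unfolding stable_sextic_def by blast
  moreover have "multiplicity l f \<le> 2"
    using assms(2) uv unfolding stable_sextic_def root_mult_def l_def by auto
  ultimately show False by simp
qed

section \<open>Assembly and the points of weighted projective space\<close>

lemma sextic_classified:
  assumes "binary_form 6 f" "stable_sextic f" "I4 f = 0"
  shows "classified (sextic_coeff f)"
proof -
  obtain c0 c1 c2 c3 where "(c0, c1, c2, c3) \<noteq> (0, 0, 0, 0)"
    "\<And>i. i \<le> 3 \<Longrightarrow> c0 * sextic_coeff f i + c1 * sextic_coeff f (i + 1)
       + c2 * sextic_coeff f (i + 2) + c3 * sextic_coeff f (i + 3) = 0"
    using I4_kernel[OF assms(3)] by blast
  then show ?thesis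
    using stable_no_triple_root[OF assms(1,2)] by (rule apolar_classified)
qed

lemma wpoint_scale:
  assumes "c \<noteq> 0"
  shows "wpoint (c * z1) (c^2 * z2) (c^3 * z3) (c^5 * z5) = wpoint z1 z2 z3 z5"
proof (cases "(z1, z2, z3, z5) = (0, 0, 0, 0)")
  case False
  then have "((z1, z2, z3, z5), (c * z1, c^2 * z2, c^3 * z3, c^5 * z5)) \<in> wproj_rel"
    using assms unfolding wproj_rel_def by blast
  then show ?thesis
    unfolding wpoint_def by (rule equiv_class_eq[OF equiv_wproj_rel, symmetric])
qed simp

theorem theorem4p6:
  fixes f :: "complex poly poly"
  assumes "f \<noteq> 0" and "binary_form 6 f" and "stable_sextic f" and "I4 f = 0"
  shows "let
      case1 = (I2 f ^ 3 + I6 f \<noteq> 0 \<and> waring_rank 6 f = 3);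
      case2a = (I2 f ^ 3 + I6 f = 0 \<and> waring_rank 6 f = 2 \<and>
                sextic_point f = wpoint 1 0 (-1) 1);
      case2b = (I2 f ^ 3 + I6 f = 0 \<and> waring_rank 6 f = 5 \<and>
                (sextic_point f = wpoint 0 0 0 1 \<or>
                 (\<exists>t. t \<noteq> 1 \<and> sextic_point f = wpoint 1 0 (-1) t)))
    in (case1 \<or> case2a \<or> case2b) \<and>
       \<not> (case1 \<and> case2a) \<and> \<not> (case1 \<and> case2b) \<and> \<not> (case2a \<and> case2b)"
proof -
  define a where "a = sextic_coeff f"
  note eq = I2_eq[of f] I6_eq[of f] I10_eq[OF assms(2)]
  have rank: "waring_rank 6 f = Suc r" if "power_sum (Suc r) a" "\<not> power_sum r a" for r
    using waring_rank_eq[OF assms(2)] that unfolding a_def by blast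
  have point: "sextic_point f = wpoint 1 0 (-1) (I10 f / I2 f ^ 5)"
    if "I2 f ^ 3 + I6 f = 0" "I2 f \<noteq> 0"
  proof -
    \<comment> \<open>Hence the vector of invariants is (1, 0, -1, \<open>I10 f / I2 f ^ 5\<close>)
      scaled by \<open>I2 f\<close>.\<close>
    have "I6 f = I2 f ^ 3 * (-1)" using that(1) by (simp add: add_eq_0_iff)
    then show ?thesis
      using wpoint_scale[OF that(2), of 1 0 "-1" "I10 f / I2 f ^ 5"] that(2) assms(4)
      by (simp add: sextic_point_def)
  qed
  have point0: "sextic_point f = wpoint 0 0 0 1"
    if "I2 f ^ 3 + I6 f = 0" "I2 f = 0" "I10 f \<noteq> 0"
  proof -
    \<comment> \<open>Here only \<open>I10 f\<close> is nonzero; as it has weight 5, a fifth root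
      scales (0, 0, 0, 1) to it.\<close>
    obtain c where c: "c ^ 5 = I10 f" using nth_root_exists[of 5] by auto
    then have "c \<noteq> 0" using that(3) by auto
    then show ?thesis
      using wpoint_scale[of c 0 0 0 1] c that assms(4) by (simp add: sextic_point_def)
  qed
  have "I2 f ^ 3 + I6 f \<noteq> 0 \<and> waring_rank 6 f = 3 \<or>
    I2 f ^ 3 + I6 f = 0 \<and> waring_rank 6 f = 2 \<and> sextic_point f = wpoint 1 0 (-1) 1 \<or>
    I2 f ^ 3 + I6 f = 0 \<and> waring_rank 6 f = 5 \<and>
      (sextic_point f = wpoint 0 0 0 1 \<or> (\<exists>t. t \<noteq> 1 \<and> sextic_point f = wpoint 1 0 (-1) t))"
  proof -
    consider "I2 f ^ 3 + I6 f \<noteq> 0" "power_sum 3 a" "\<not> power_sum 2 a"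
      | "I2 f ^ 3 + I6 f = 0" "power_sum 2 a" "\<not> power_sum 1 a" "I2 f \<noteq> 0" "I10 f = I2 f ^ 5"
      | "I2 f ^ 3 + I6 f = 0" "power_sum 5 a" "\<not> power_sum 4 a" "I10 f \<noteq> I2 f ^ 5"
      using sextic_classified[OF assms(2-4)] unfolding classified_def eq a_def by blast
    then show ?thesis
    proof cases
      case 1
      then show ?thesis using rank[of 2] by simp
    next
      case 2
      then show ?thesis using rank[of 1] point by (simp add: numeral_2_eq_2)
    next
      case 3
      then have "waring_rank 6 f = 5" using rank[of 4] by simp
      moreover have "sextic_point f = wpoint 0 0 0 1 \<or> (\<exists>t. t \<noteq> 1 \<and> sextic_point f = wpoint 1 0 (-1) t)"
      proof (cases "I2 f = 0")
        case True
        then show ?thesis using point0 3 by simp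
      next
        case False
        then have "I10 f / I2 f ^ 5 \<noteq> 1" using 3 by simp
        then show ?thesis using point[OF 3(1) False] by blast
      qed
      ultimately show ?thesis using 3(1) by blast
    qed
  qed
  \<comment> \<open>The cases exclude each other through \<open>I2 f ^ 3 + I6 f\<close> and the rank
    alone.\<close>
  then show ?thesis unfolding Let_def by auto
qed

end
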